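(* For every $0\le C_0<\infty$ there is a constant $C_{\mathrm{perm}}=C_{\mathrm{perm}}(C_0)<\infty$ with the following property. For every sequence $\eta_\bullet=(\eta_n)_{n\ge1}$ with $\eta_n\ge0$ and $\eta_n\to0$, there is an index $n_0=n_0(C_0,\eta_\bullet)$ such that, for every $n\ge n_0$ and every real $n\times n$ matrix $E$ satisfying $$E\mathbf 1=E^{\mathsf T}\mathbf 1=0,\qquad \mathcal J+E\ge0\ \text{entrywise},\qquad \max_{i,j}|E_{ij}|\le C_0,\qquad s(E)\le\eta_n n,$$ one has $$\left|\log\frac{\operatorname{per}(\mathcal J+E)}{n!}+\frac12\log\det\left(I-\frac{E^{\mathsf T}E}{n^2}\right)\right|\le C_{\mathrm{perm}}\frac{s(E)}{n^2}.$$ The constant $C_{\mathrm{perm}}$ is independent of the sequence $\eta_\bullet$, of $n$, and of the matrix $E$; the threshold $n_0$ may depend on $C_0$ and $\eta_\bullet$.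
   Context: $\mathcal J$ is the $n\times n$ all-ones matrix, $\mathbf 1$ is the all-ones vector, $\operatorname{per}$ is the permanent, and for a real $n\times n$ matrix $E$ $$s(E)=\max\Bigl\{\max_i\sum_j|E_{ij}|,\ \max_j\sum_i|E_{ij}|\Bigr\}.$$ *)

theory Defs
  imports Complex_Main "Jordan_Normal_Form.Determinant"
begin

text \<open>As with the library determinant, the permanent is set to 0 on non-square matrices.\<close>

definition permanent :: "'a::comm_semiring_1 mat \<Rightarrow> 'a" where
  "permanent A =
     (if dim_row A = dim_col A
      then \<Sum>p\<in>{p. p permutes {0..<dim_row A}}. \<Prod>i = 0..<dim_row A. A $$ (i, p i)
      else 0)"

definition all_ones_mat :: "nat \<Rightarrow> 'a::one mat" where
  "all_ones_mat n = mat n n (\<lambda>(i, j). 1)"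

definition all_ones_vec :: "nat \<Rightarrow> 'a::one vec" where
  "all_ones_vec n = vec n (\<lambda>i. 1)"

text \<open>The maxima in the next two definitions are meaningful only for matrices with at least
  one row and one column, since \<open>Max {}\<close> is unspecified.\<close>

definition max_abs_entry :: "real mat \<Rightarrow> real" where
  "max_abs_entry E = Max ((\<lambda>(i, j). \<bar>E $$ (i, j)\<bar>) ` ({0..<dim_row E} \<times> {0..<dim_col E}))"

definition max_abs_line_sum :: "real mat \<Rightarrow> real" where
  "max_abs_line_sum E =
     max (Max ((\<lambda>i. \<Sum>j = 0..<dim_col E. \<bar>E $$ (i, j)\<bar>) ` {0..<dim_row E}))
         (Max ((\<lambda>j. \<Sum>i = 0..<dim_row E. \<bar>E $$ (i, j)\<bar>) ` {0..<dim_col E}))"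

end

theory Submission
  imports Defs "HOL-Library.FuncSet" "HOL-Combinatorics.Permutations"
    "HOL-Computational_Algebra.Formal_Power_Series" "Jordan_Normal_Form.Schur_Decomposition"
begin

text \<open>
Write \<open>s\<close> for the largest absolute line sum of \<open>E\<close>. Since the entries of \<open>E\<close> are bounded and \<open>s / n\<close> is
small, both \<open>per (J + E) / n!\<close> and \<open>det (I - E\<^sup>T E / n\<^sup>2)\<^bsup>-1/2\<^esup>\<close> are close to 1. It therefore suffices to
compare them additively with error \<open>O(s / n\<^sup>2)\<close>, and this is done term by term in the degree \<open>k\<close> in \<open>E\<close>.
It is enough that \<open>s / n\<close> is below a threshold \<open>\<theta>\<^sup>2\<close> depending on \<open>C0\<close>, which is why the constant does
not depend on the sequence \<open>\<eta>\<close>.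

The part of degree \<open>k\<close> of \<open>per (J + E) / n!\<close> is \<open>(n - k)! / (n! k!)\<close> times the sum of
\<open>\<Prod>e<k. E (i e) (j e)\<close> over injective row labels \<open>i\<close> and column labels \<open>j\<close> (\<open>permanent_ones_plus\<close>).
Both injectivity constraints are expanded into signed sums over forests (\<open>inj_on_eq_forest_sum\<close>), whose
components prescribe which labels coincide. A pair of forests describes a bipartite multigraph with \<open>k\<close>
edges and \<open>v\<close> vertices, one per component. Because all line sums of \<open>E\<close> vanish, multigraphs with a
vertex of degree one cancel (\<open>edge_sum_eq_0_left\<close>). Hence \<open>v \<le> k\<close>, with equality exactly when all degrees
are two, and then the multigraph is a union of even cycles.

The unions of cycles give the pairing sum, which by Isserlis' theorem is the \<open>k\<close>-th moment of
\<open>x \<bullet> E y\<close> for Gaussian vectors \<open>x\<close> and \<open>y\<close>; dividing by \<open>k! n\<^bsup>k\<^esup>\<close> and summing over \<open>k\<close> yields exactly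
\<open>det (I - E\<^sup>T E / n\<^sup>2)\<^bsup>-1/2\<^esup>\<close>. This is proved without integrals: integration by parts becomes the recursion
\<open>marked_wick_sum_rec\<close>, which expresses the moments through the traces of the powers of \<open>E\<^sup>T E\<close>, and
comparing logarithmic derivatives of power series gives \<open>wick_series_squared_det\<close>.

All other multigraphs have \<open>v \<le> k - 1\<close>. The contribution of one multigraph is at most
\<open>C\<^bsup>k\<^esup> sqrt (n s)\<^bsup>v\<^esup>\<close> (\<open>edge_sum_abs_le\<close>), which after division by \<open>n\<^bsup>k\<^esup>\<close> is \<open>C\<^bsup>k\<^esup> (s / n)\<^bsup>v/2\<^esup> n\<^bsup>-(k-v)\<^esup>\<close>:
one factor \<open>s / n\<close> because \<open>v \<ge> 2\<close>, one factor \<open>1 / n\<close> because \<open>v < k\<close>, and a small factor per vertex.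
The number of pairs of forests is of order \<open>(k!)\<^sup>2\<close>, against the prefactor \<open>1 / k!\<close>, but the generating
function of forests by the number of roots is a rising factorial (\<open>sum_power_roots\<close>), and for \<open>k \<le> n \<theta>\<close> the
powers of \<open>1 / n\<close> make up for the surplus, leaving a geometric series
(\<open>injective_sum_minus_wick_sum_le\<close>). For \<open>k > n \<theta>\<close> a bound without any cancellation is enough
(\<open>injective_sum_le\<close>).
\<close>

section \<open>Forests and the expansion of injectivity\<close>

text \<open>A function in \<open>forests K\<close> sends every vertex to a parent that is no larger; the fixed points are the
roots. The ordering makes the choices of different vertices independent, so that sums over forests
factor over the vertices.\<close>

definition forests :: "nat set \<Rightarrow> (nat \<Rightarrow> nat) set" where
  "forests K = (\<Pi>\<^sub>E a\<in>K. {b \<in> K. b \<le> a})"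

definition roots :: "nat set \<Rightarrow> (nat \<Rightarrow> nat) \<Rightarrow> nat set" where
  "roots K f = {a \<in> K. f a = a}"

definition forest_sign :: "nat set \<Rightarrow> (nat \<Rightarrow> nat) \<Rightarrow> real" where
  "forest_sign K f = (\<Prod>a\<in>K. if f a = a then 1 else - 1)"

definition labellings :: "nat \<Rightarrow> nat set \<Rightarrow> (nat \<Rightarrow> nat) set" where
  "labellings n K = K \<rightarrow>\<^sub>E {..<n}"

definition compatible :: "nat set \<Rightarrow> (nat \<Rightarrow> nat) \<Rightarrow> (nat \<Rightarrow> nat) \<Rightarrow> bool" where
  "compatible K f i \<longleftrightarrow> (\<forall>a\<in>K. i (f a) = i a)"

text \<open>The elements of \<open>K\<close> are the edges of a bipartite multigraph. The components of \<open>f\<close> say which edges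
share a row vertex and those of \<open>g\<close> which edges share a column vertex; \<open>edge_sum\<close> sums the product of
the matrix entries over all ways to place the vertices, not necessarily injectively.\<close>

definition edge_sum :: "(nat \<Rightarrow> nat \<Rightarrow> real) \<Rightarrow> nat \<Rightarrow> nat set \<Rightarrow> (nat \<Rightarrow> nat) \<Rightarrow> (nat \<Rightarrow> nat) \<Rightarrow> real" where
  "edge_sum E n K f g =
     (\<Sum>i\<in>{i \<in> labellings n K. compatible K f i}. \<Sum>j\<in>{j \<in> labellings n K. compatible K g j}.
        \<Prod>e\<in>K. E (i e) (j e))"

definition injective_sum :: "(nat \<Rightarrow> nat \<Rightarrow> real) \<Rightarrow> nat \<Rightarrow> nat set \<Rightarrow> real" where
  "injective_sum E n K = (\<Sum>i\<in>{i \<in> labellings n K. inj_on i K}. \<Sum>j\<in>{j \<in> labellings n K. inj_on j K}.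
     \<Prod>e\<in>K. E (i e) (j e))"

lemma finite_forests [simp]: "finite K \<Longrightarrow> finite (forests K)"
  by (auto simp: forests_def intro!: finite_PiE)

lemma finite_labellings [simp]: "finite K \<Longrightarrow> finite (labellings n K)"
  by (auto simp: labellings_def intro!: finite_PiE)

lemma finite_roots [simp]: "finite K \<Longrightarrow> finite (roots K f)"
  by (auto simp: roots_def)

lemma roots_subset: "roots K f \<subseteq> K"
  by (auto simp: roots_def)

lemma sum_filter_of_bool:
  fixes h :: "'a \<Rightarrow> 'b::semiring_1"
  assumes "finite A"
  shows "(\<Sum>x\<in>{x \<in> A. P x}. h x) = (\<Sum>x\<in>A. of_bool (P x) * h x)"
  by (subst sum.inter_filter[OF assms], rule sum.cong) auto

text \<open>Injectivity of \<open>i\<close> is the product over \<open>a\<close> of \<open>1 - #{b < a. i b = i a}\<close>. This is clear when \<open>i\<close> is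
injective. Otherwise, at the first repetition the earlier values are still distinct, exactly one
\<open>b\<close> matches, and the factor vanishes. Multiplying out, a vertex either contributes the \<open>1\<close> and is a
root, or contributes \<open>-1\<close> and hangs below the matching \<open>b\<close>. In contrast to inclusion-exclusion over
set partitions, no factorials appear as weights.\<close>

lemma inj_on_eq_forest_sum:
  assumes K: "finite K"
  shows "of_bool (inj_on i K) = (\<Sum>f\<in>{f \<in> forests K. compatible K f i}. forest_sign K f)"
proof -
  define w where "w a b = (if i b = i a then if b = a then 1 else - 1 else (0::real))" for a b
  have "(\<Sum>f\<in>{f \<in> forests K. compatible K f i}. forest_sign K f)
      = (\<Sum>f\<in>forests K. if compatible K f i then forest_sign K f else 0)"
    using K by (simp add: sum.inter_filter)
  also have "\<dots> = (\<Sum>f\<in>forests K. \<Prod>a\<in>K. w a (f a))"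
  proof (rule sum.cong[OF refl])
    fix f
    show "(if compatible K f i then forest_sign K f else 0) = (\<Prod>a\<in>K. w a (f a))"
    proof (cases "compatible K f i")
      case True
      then show ?thesis
        by (auto simp: compatible_def forest_sign_def w_def intro!: prod.cong)
    next
      case False
      then obtain a where "a \<in> K" "i (f a) \<noteq> i a" by (auto simp: compatible_def)
      then have "(\<Prod>a\<in>K. w a (f a)) = 0"
        using K by (intro prod_zero bexI[of _ a]) (auto simp: w_def)
      with False show ?thesis by simp
    qed
  qed
  also have "\<dots> = (\<Prod>a\<in>K. \<Sum>b\<in>{b \<in> K. b \<le> a}. w a b)"
    unfolding forests_def using K by (subst prod_sum_PiE) auto
  also have "\<dots> = of_bool (inj_on i K)"
  proof (cases "inj_on i K")
    case True
    have "(\<Sum>b\<in>{b \<in> K. b \<le> a}. w a b) = 1" if "a \<in> K" for a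
    proof -
      have "(\<Sum>b\<in>{b \<in> K. b \<le> a}. w a b) = (\<Sum>b\<in>{b \<in> K. b \<le> a}. if b = a then 1 else 0)"
        using True that by (intro sum.cong) (auto simp: w_def inj_on_def)
      then show ?thesis using K that by simp
    qed
    then show ?thesis using True by simp
  next
    case False
    define P where "P a \<longleftrightarrow> a \<in> K \<and> (\<exists>b\<in>K. b < a \<and> i b = i a)" for a
    have "\<exists>a. P a"
      using False unfolding inj_on_def P_def by (metis linorder_neqE_nat)
    then have a: "P (LEAST a. P a)" by (rule LeastI_ex)
    define a where "a = (LEAST a. P a)"
    from a obtain b where b: "a \<in> K" "b \<in> K" "b < a" "i b = i a" by (auto simp: P_def a_def)
    have min: "a \<le> c" if "P c" for c using that unfolding a_def by (rule Least_le)
    have uniq: "c = b" if "c \<in> K" "c < a" "i c = i a" for c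
    proof (rule linorder_cases[of c b])
      assume "c < b"
      then have "P b" using that b by (auto simp: P_def)
      with min[of b] b show ?thesis by simp
    next
      assume "b < c"
      then have "P c" using that b by (auto simp: P_def)
      with min[of c] that show ?thesis by simp
    qed
    have "(\<Sum>c\<in>{c \<in> K. c \<le> a}. w a c)
        = (\<Sum>c\<in>{c \<in> K. c \<le> a}. (if c = a then 1 else 0) + (if c = b then - 1 else 0))"
    proof (rule sum.cong[OF refl])
      fix c assume c: "c \<in> {c \<in> K. c \<le> a}"
      show "w a c = (if c = a then 1 else 0) + (if c = b then - 1 else 0)"
      proof (cases "c = a")
        case True
        then show ?thesis using b by (simp add: w_def)
      next
        case False
        then have "i c = i a \<longleftrightarrow> c = b" using uniq[of c] b c by auto
        then show ?thesis using False by (simp add: w_def)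
      qed
    qed
    also have "\<dots> = 0"
      using K b by (subst sum.distrib) simp
    finally have "(\<Prod>a\<in>K. \<Sum>b\<in>{b \<in> K. b \<le> a}. w a b) = 0"
      using b K by (intro prod_zero) auto
    then show ?thesis using False by simp
  qed
  finally show ?thesis by simp
qed

lemma sum_swap_pairs:
  "(\<Sum>i\<in>A. \<Sum>j\<in>B. \<Sum>f\<in>C. \<Sum>g\<in>D. h i j f g)
   = (\<Sum>f\<in>C. \<Sum>g\<in>D. \<Sum>i\<in>A. \<Sum>j\<in>B. h i j f g)"
proof -
  have "(\<Sum>i\<in>A. \<Sum>j\<in>B. \<Sum>f\<in>C. \<Sum>g\<in>D. h i j f g)
      = (\<Sum>i\<in>A. \<Sum>f\<in>C. \<Sum>j\<in>B. \<Sum>g\<in>D. h i j f g)"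
    by (rule sum.cong[OF refl], rule sum.swap)
  also have "\<dots> = (\<Sum>f\<in>C. \<Sum>i\<in>A. \<Sum>j\<in>B. \<Sum>g\<in>D. h i j f g)"
    by (rule sum.swap)
  also have "\<dots> = (\<Sum>f\<in>C. \<Sum>i\<in>A. \<Sum>g\<in>D. \<Sum>j\<in>B. h i j f g)"
    by (rule sum.cong[OF refl], rule sum.cong[OF refl], rule sum.swap)
  also have "\<dots> = (\<Sum>f\<in>C. \<Sum>g\<in>D. \<Sum>i\<in>A. \<Sum>j\<in>B. h i j f g)"
    by (rule sum.cong[OF refl], rule sum.swap)
  finally show ?thesis .
qed

lemma injective_sum_eq_forest_sum:
  assumes K: "finite K"
  shows "injective_sum E n K
       = (\<Sum>f\<in>forests K. \<Sum>g\<in>forests K. forest_sign K f * forest_sign K g * edge_sum E n K f g)"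
proof -
  let ?L = "labellings n K" and ?F = "forests K" and ?s = "forest_sign K"
  let ?P = "\<lambda>i j. \<Prod>e\<in>K. E (i e) (j e)"
  have ind: "of_bool (inj_on i K) = (\<Sum>f\<in>?F. of_bool (compatible K f i) * ?s f)" for i
    using K by (simp only: inj_on_eq_forest_sum sum_filter_of_bool finite_forests)
  have "injective_sum E n K
      = (\<Sum>i\<in>?L. \<Sum>j\<in>?L. of_bool (inj_on i K) * of_bool (inj_on j K) * ?P i j)"
    unfolding injective_sum_def using K
    by (simp only: sum_filter_of_bool finite_labellings sum_distrib_left mult.assoc)
  also have "\<dots> = (\<Sum>i\<in>?L. \<Sum>j\<in>?L. \<Sum>f\<in>?F. \<Sum>g\<in>?F.
      ?s f * ?s g * (of_bool (compatible K f i) * of_bool (compatible K g j) * ?P i j))"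
    by (intro sum.cong refl, subst ind, subst ind, subst sum_product)
       (simp only: sum_distrib_left sum_distrib_right mult_ac)
  also have "\<dots> = (\<Sum>f\<in>?F. \<Sum>g\<in>?F. \<Sum>i\<in>?L. \<Sum>j\<in>?L.
      ?s f * ?s g * (of_bool (compatible K f i) * of_bool (compatible K g j) * ?P i j))"
    by (rule sum_swap_pairs)
  also have "\<dots> = (\<Sum>f\<in>?F. \<Sum>g\<in>?F. ?s f * ?s g * edge_sum E n K f g)"
  proof (intro sum.cong refl)
    fix f g
    have "edge_sum E n K f g
        = (\<Sum>i\<in>?L. \<Sum>j\<in>?L. of_bool (compatible K f i) * of_bool (compatible K g j) * ?P i j)"
      using K unfolding edge_sum_def
      by (simp only: sum_filter_of_bool finite_labellings sum_distrib_left mult.assoc)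
    then show "(\<Sum>i\<in>?L. \<Sum>j\<in>?L.
      ?s f * ?s g * (of_bool (compatible K f i) * of_bool (compatible K g j) * ?P i j))
      = ?s f * ?s g * edge_sum E n K f g"
      by (simp add: sum_distrib_left)
  qed
  finally show ?thesis .
qed

lemma edge_sum_transpose: "edge_sum (\<lambda>x y. E y x) n K f g = edge_sum E n K g f"
  unfolding edge_sum_def by (rule sum.swap)

lemma compatible_determined_by_roots:
  assumes f: "f \<in> forests K" and i: "compatible K f i" and j: "compatible K f j"
    and eq: "\<And>r. r \<in> roots K f \<Longrightarrow> i r = j r" and a: "a \<in> K"
  shows "i a = j a"
  using a
proof (induction a rule: less_induct)
  case (less a)
  show ?case
  proof (cases "f a = a")
    case True
    then show ?thesis using eq less.prems by (auto simp: roots_def)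
  next
    case False
    have "f a \<in> K" "f a \<le> a" using f less.prems by (auto simp: forests_def)
    with False less.IH[of "f a"] have "i (f a) = j (f a)" by auto
    then show ?thesis using i j less.prems by (auto simp: compatible_def)
  qed
qed

lemma inj_on_restrict_roots:
  assumes f: "f \<in> forests K"
  shows "inj_on (\<lambda>i. restrict i (roots K f)) {i \<in> labellings n K. compatible K f i}"
proof (rule inj_onI)
  fix i j
  assume i: "i \<in> {i \<in> labellings n K. compatible K f i}"
    and j: "j \<in> {i \<in> labellings n K. compatible K f i}"
    and eq: "restrict i (roots K f) = restrict j (roots K f)"
  have "i a = j a" if "a \<in> K" for a
  proof (rule compatible_determined_by_roots[OF f _ _ _ that])
    fix r assume "r \<in> roots K f"
    then show "i r = j r" using fun_cong[OF eq, of r] by simp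
  qed (use i j in auto)
  then show "i = j"
    using i j by (auto simp: labellings_def intro: PiE_ext)
qed

lemma card_compatible_le:
  assumes K: "finite K" and f: "f \<in> forests K"
  shows "card {i \<in> labellings n K. compatible K f i} \<le> n ^ card (roots K f)"
proof -
  have "card {i \<in> labellings n K. compatible K f i} \<le> card (roots K f \<rightarrow>\<^sub>E {..<n})"
  proof (rule card_inj_on_le[OF inj_on_restrict_roots[OF f]])
    show "(\<lambda>i. restrict i (roots K f)) ` {i \<in> labellings n K. compatible K f i} \<subseteq> roots K f \<rightarrow>\<^sub>E {..<n}"
      using roots_subset by (fastforce simp: labellings_def)
  qed (use K in \<open>auto intro!: finite_PiE\<close>)
  also have "\<dots> = n ^ card (roots K f)"
    using K by (simp add: card_PiE)
  finally show ?thesis .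
qed

text \<open>A labelling that is compatible with \<open>f\<close> is free only on the roots. Keeping one entry of \<open>E\<close> per root and
bounding all others by \<open>C\<close>, the remaining sum factors into column sums of \<open>\<bar>E\<bar>\<close>.\<close>

lemma sum_compatible_le:
  fixes E :: "nat \<Rightarrow> nat \<Rightarrow> real"
  assumes K: "finite K" and f: "f \<in> forests K" and j: "j \<in> labellings n K"
    and E: "\<And>x y. x < n \<Longrightarrow> y < n \<Longrightarrow> \<bar>E x y\<bar> \<le> C" and C: "1 \<le> C"
    and col: "\<And>y. y < n \<Longrightarrow> (\<Sum>x<n. \<bar>E x y\<bar>) \<le> s"
  shows "(\<Sum>i\<in>{i \<in> labellings n K. compatible K f i}. \<Prod>e\<in>K. \<bar>E (i e) (j e)\<bar>)
         \<le> C ^ card K * s ^ card (roots K f)"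
proof -
  let ?R = "roots K f" and ?A = "{i \<in> labellings n K. compatible K f i}"
  have "(\<Prod>e\<in>K. \<bar>E (i e) (j e)\<bar>) \<le> C ^ card K * (\<Prod>e\<in>?R. \<bar>E (restrict i ?R e) (j e)\<bar>)"
    if i: "i \<in> ?A" for i
  proof -
    have "(\<Prod>e\<in>K. \<bar>E (i e) (j e)\<bar>) = (\<Prod>e\<in>K - ?R. \<bar>E (i e) (j e)\<bar>) * (\<Prod>e\<in>?R. \<bar>E (i e) (j e)\<bar>)"
      using K roots_subset by (simp add: prod.subset_diff)
    also have "(\<Prod>e\<in>K - ?R. \<bar>E (i e) (j e)\<bar>) \<le> C ^ card (K - ?R)"
    proof -
      have "(\<Prod>e\<in>K - ?R. \<bar>E (i e) (j e)\<bar>) \<le> (\<Prod>e\<in>K - ?R. C)"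
        by (rule prod_mono) (use E i j in \<open>auto simp: labellings_def PiE_def Pi_def\<close>)
      then show ?thesis by simp
    qed
    also have "\<dots> \<le> C ^ card K"
      using C K by (intro power_increasing card_mono) auto
    finally show ?thesis
      by (simp add: mult_right_mono prod_nonneg)
  qed
  then have "(\<Sum>i\<in>?A. \<Prod>e\<in>K. \<bar>E (i e) (j e)\<bar>)
      \<le> (\<Sum>i\<in>?A. C ^ card K * (\<Prod>e\<in>?R. \<bar>E (restrict i ?R e) (j e)\<bar>))"
    by (rule sum_mono)
  also have "\<dots> = C ^ card K * (\<Sum>i\<in>(\<lambda>i. restrict i ?R) ` ?A. \<Prod>e\<in>?R. \<bar>E (i e) (j e)\<bar>)"
    by (subst sum.reindex[OF inj_on_restrict_roots[OF f]]) (simp add: sum_distrib_left)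
  also have "(\<Sum>i\<in>(\<lambda>i. restrict i ?R) ` ?A. \<Prod>e\<in>?R. \<bar>E (i e) (j e)\<bar>)
      \<le> (\<Sum>i\<in>?R \<rightarrow>\<^sub>E {..<n}. \<Prod>e\<in>?R. \<bar>E (i e) (j e)\<bar>)"
    using K roots_subset[of K f]
    by (intro sum_mono2 finite_PiE) (fastforce simp: labellings_def intro!: prod_nonneg)+
  also have "\<dots> = (\<Prod>e\<in>?R. \<Sum>x<n. \<bar>E x (j e)\<bar>)"
    using K by (subst prod_sum_PiE) auto
  also have "\<dots> \<le> (\<Prod>e\<in>?R. s)"
    using col j roots_subset[of K f]
    by (intro prod_mono) (fastforce simp: labellings_def intro!: sum_nonneg)
  finally show ?thesis using C by (simp add: mult_left_mono)
qed

lemma edge_sum_abs_le_one_sided: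
  assumes K: "finite K" and f: "f \<in> forests K" and g: "g \<in> forests K"
    and E: "\<And>x y. x < n \<Longrightarrow> y < n \<Longrightarrow> \<bar>E x y\<bar> \<le> C" and C: "1 \<le> C"
    and col: "\<And>y. y < n \<Longrightarrow> (\<Sum>x<n. \<bar>E x y\<bar>) \<le> s" and s: "0 \<le> s"
  shows "\<bar>edge_sum E n K f g\<bar> \<le> C ^ card K * s ^ card (roots K f) * real n ^ card (roots K g)"
proof -
  let ?A = "{i \<in> labellings n K. compatible K f i}" and ?B = "{j \<in> labellings n K. compatible K g j}"
  have "\<bar>edge_sum E n K f g\<bar> \<le> (\<Sum>j\<in>?B. \<Sum>i\<in>?A. \<Prod>e\<in>K. \<bar>E (i e) (j e)\<bar>)"
    unfolding edge_sum_def sum.swap[of _ ?B ?A]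
    by (intro order.trans[OF sum_abs] sum_mono) (simp add: abs_prod)
  also have "\<dots> \<le> (\<Sum>j\<in>?B. C ^ card K * s ^ card (roots K f))"
    using sum_compatible_le[OF K f _ E C col] by (intro sum_mono) auto
  also have "\<dots> = real (card ?B) * (C ^ card K * s ^ card (roots K f))" by simp
  also have "\<dots> \<le> real (n ^ card (roots K g)) * (C ^ card K * s ^ card (roots K f))"
    using card_compatible_le[OF K g, of n] C s
    by (intro mult_right_mono of_nat_mono) auto
  finally show ?thesis by (simp add: mult_ac)
qed

text \<open>Summing over the row labels first gains \<open>s\<close> per row vertex and \<open>n\<close> per column vertex; summing over
the column labels first does the opposite. The geometric mean of the two bounds gains \<open>sqrt (n s)\<close> for
every vertex, irrespective of how the multigraph is connected.\<close>

lemma edge_sum_abs_le: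
  assumes K: "finite K" and f: "f \<in> forests K" and g: "g \<in> forests K"
    and E: "\<And>x y. x < n \<Longrightarrow> y < n \<Longrightarrow> \<bar>E x y\<bar> \<le> C" and C: "1 \<le> C"
    and col: "\<And>y. y < n \<Longrightarrow> (\<Sum>x<n. \<bar>E x y\<bar>) \<le> s"
    and row: "\<And>x. x < n \<Longrightarrow> (\<Sum>y<n. \<bar>E x y\<bar>) \<le> s" and s: "0 \<le> s"
  shows "\<bar>edge_sum E n K f g\<bar>
         \<le> C ^ card K * sqrt (real n * s) ^ (card (roots K f) + card (roots K g))"
proof -
  let ?p = "card (roots K f)" and ?q = "card (roots K g)"
  have 1: "\<bar>edge_sum E n K f g\<bar> \<le> C ^ card K * s ^ ?p * real n ^ ?q"
    by (rule edge_sum_abs_le_one_sided[OF K f g E C col s])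
  have "\<bar>edge_sum (\<lambda>x y. E y x) n K g f\<bar> \<le> C ^ card K * s ^ ?q * real n ^ ?p"
    by (rule edge_sum_abs_le_one_sided[OF K g f _ C _ s]) (use E row in auto)
  then have 2: "\<bar>edge_sum E n K f g\<bar> \<le> C ^ card K * s ^ ?q * real n ^ ?p"
    by (simp only: edge_sum_transpose[of E])
  have "\<bar>edge_sum E n K f g\<bar>\<^sup>2 \<le> (C ^ card K * s ^ ?p * real n ^ ?q) * (C ^ card K * s ^ ?q * real n ^ ?p)"
    unfolding power2_eq_square using 1 2 C s by (intro mult_mono) auto
  also have "\<dots> = (C ^ card K * sqrt (real n * s) ^ (?p + ?q))\<^sup>2"
  proof -
    have "(sqrt (real n * s) ^ (?p + ?q))\<^sup>2 = ((sqrt (real n * s))\<^sup>2) ^ (?p + ?q)"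
      by (metis power_mult mult.commute)
    also have "\<dots> = (real n * s) ^ ?p * (real n * s) ^ ?q"
      using s by (simp add: power_add)
    finally have eq: "(sqrt (real n * s) ^ (?p + ?q))\<^sup>2 = (real n * s) ^ ?p * (real n * s) ^ ?q" .
    show ?thesis
      unfolding power_mult_distrib[of "C ^ card K"] eq
      by (simp only: power_mult_distrib power2_eq_square mult_ac)
  qed
  finally show ?thesis
    by (rule power2_le_imp_le) (use C s in simp)
qed

section \<open>Vanishing terms and pairings\<close>

lemma sum_labellings_insert:
  assumes "finite K" "a \<notin> K"
  shows "(\<Sum>i\<in>labellings n (insert a K). h i) = (\<Sum>x<n. \<Sum>i\<in>labellings n K. h (i(a := x)))"
proof -
  have inj: "inj_on (\<lambda>(x, i). i(a := x)) ({..<n} \<times> labellings n K)"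
    using assms(2) unfolding labellings_def by (rule inj_combinator)
  show ?thesis
    unfolding labellings_def PiE_insert_eq
    using inj by (subst sum.reindex) (auto simp: labellings_def sum.cartesian_product split_def)
qed

text \<open>No component is a single vertex: following parents from any vertex of a larger component ends at
its root, so the root has a child other than itself.\<close>

definition sprouting :: "nat set \<Rightarrow> (nat \<Rightarrow> nat) \<Rightarrow> bool" where
  "sprouting K f \<longleftrightarrow> roots K f \<subseteq> f ` (K - roots K f)"

text \<open>The forests all of whose components have exactly two vertices, that is, the perfect matchings of \<open>K\<close>.\<close>

definition pairings :: "nat set \<Rightarrow> (nat \<Rightarrow> nat) set" where
  "pairings K = {f \<in> forests K. bij_betw f (K - roots K f) (roots K f)}"

lemma finite_pairings [simp]: "finite K \<Longrightarrow> finite (pairings K)"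
  by (simp add: pairings_def)

text \<open>A component consisting of one edge \<open>a\<close> leaves the label of \<open>a\<close> free, and this label occurs only in
the factor of \<open>a\<close>. Summing over it gives a column sum of \<open>E\<close>.\<close>

lemma edge_sum_eq_0_left:
  assumes K: "finite K" and f: "f \<in> forests K" and ns: "\<not> sprouting K f"
    and col: "\<And>y. y < n \<Longrightarrow> (\<Sum>x<n. E x y) = 0"
  shows "edge_sum E n K f g = 0"
proof -
  from ns obtain a where ar: "a \<in> roots K f" "a \<notin> f ` (K - roots K f)"
    by (auto simp: sprouting_def)
  then have a: "a \<in> K" "f a = a" by (auto simp: roots_def)
  have leaf: "f c \<noteq> a" if "c \<in> K" "c \<noteq> a" for c
  proof
    assume "f c = a"
    with that ar show False by (cases "c \<in> roots K f") (auto simp: roots_def)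
  qed
  define K' where "K' = K - {a}"
  have K': "K = insert a K'" "finite K'" "a \<notin> K'" using a K by (auto simp: K'_def)
  have comp: "compatible K f (i(a := x)) \<longleftrightarrow> compatible K' f i" for i x
    using a leaf by (auto simp: compatible_def K'_def)
  have zero: "(\<Sum>i\<in>{i \<in> labellings n K. compatible K f i}. \<Prod>e\<in>K. E (i e) (j e)) = 0"
    if j: "j \<in> labellings n K" for j
  proof -
    have ja: "j a < n" using j a by (auto simp: labellings_def)
    have "(\<Sum>i\<in>{i \<in> labellings n K. compatible K f i}. \<Prod>e\<in>K. E (i e) (j e))
        = (\<Sum>i\<in>labellings n K. of_bool (compatible K f i) * (\<Prod>e\<in>K. E (i e) (j e)))"
      using K by (simp only: sum_filter_of_bool finite_labellings)
    also have "\<dots> = (\<Sum>i\<in>labellings n K'. \<Sum>x<n.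
        of_bool (compatible K f (i(a := x))) * (\<Prod>e\<in>K. E ((i(a := x)) e) (j e)))"
      unfolding K'(1) by (subst sum_labellings_insert[OF K'(2,3)]) (rule sum.swap)
    also have "\<dots> = (\<Sum>i\<in>labellings n K'. \<Sum>x<n.
        of_bool (compatible K' f i) * (\<Prod>e\<in>K'. E (i e) (j e)) * E x (j a))"
    proof (intro sum.cong refl)
      fix i x
      have "(\<Prod>e\<in>K. E ((i(a := x)) e) (j e)) = E x (j a) * (\<Prod>e\<in>K'. E ((i(a := x)) e) (j e))"
        unfolding K'(1) using K' by simp
      also have "(\<Prod>e\<in>K'. E ((i(a := x)) e) (j e)) = (\<Prod>e\<in>K'. E (i e) (j e))"
        using K' by (intro prod.cong) auto
      finally show "of_bool (compatible K f (i(a := x))) * (\<Prod>e\<in>K. E ((i(a := x)) e) (j e))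
          = of_bool (compatible K' f i) * (\<Prod>e\<in>K'. E (i e) (j e)) * E x (j a)"
        by (simp add: comp)
    qed
    also have "\<dots> = 0"
      using col[OF ja] by (simp flip: sum_distrib_left)
    finally show ?thesis .
  qed
  show ?thesis
    unfolding edge_sum_def by (subst sum.swap) (simp add: zero)
qed

lemma edge_sum_eq_0_right:
  assumes "finite K" "g \<in> forests K" "\<not> sprouting K g"
    and "\<And>x. x < n \<Longrightarrow> (\<Sum>y<n. E x y) = 0"
  shows "edge_sum E n K f g = 0"
  using edge_sum_eq_0_left[of K g n "\<lambda>x y. E y x" f] assms by (simp add: edge_sum_transpose[of E])

lemma card_roots_add:
  "finite K \<Longrightarrow> card (roots K f) + card (K - roots K f) = card K"
  by (metis card_Diff_subset card_mono finite_roots le_add_diff_inverse roots_subset)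

lemma sprouting_card:
  assumes K: "finite K" and s: "sprouting K f"
  shows "2 * card (roots K f) \<le> card K"
proof -
  have "card (roots K f) \<le> card (K - roots K f)"
    using s K unfolding sprouting_def by (meson finite_Diff surj_card_le)
  then show ?thesis using card_roots_add[OF K, of f] by linarith
qed

text \<open>Pairings are the extreme case of \<open>sprouting_card\<close>. Every other pair of sprouting forests on \<open>k\<close>
edges therefore has at most \<open>k - 1\<close> vertices, which is where the factor \<open>1 / n\<close> in the error comes from.\<close>

lemma pairings_eq:
  assumes K: "finite K"
  shows "pairings K = {f \<in> forests K. sprouting K f \<and> 2 * card (roots K f) = card K}"
proof (intro equalityI subsetI)
  fix f assume "f \<in> pairings K"
  then have f: "f \<in> forests K" "bij_betw f (K - roots K f) (roots K f)" by (auto simp: pairings_def)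
  have "card (K - roots K f) = card (roots K f)" using f(2) by (rule bij_betw_same_card)
  moreover have "sprouting K f" using f(2) by (auto simp: sprouting_def bij_betw_def)
  ultimately show "f \<in> {f \<in> forests K. sprouting K f \<and> 2 * card (roots K f) = card K}"
    using f card_roots_add[OF K, of f] by auto
next
  fix f assume "f \<in> {f \<in> forests K. sprouting K f \<and> 2 * card (roots K f) = card K}"
  then have f: "f \<in> forests K" "sprouting K f" "2 * card (roots K f) = card K" by auto
  let ?N = "K - roots K f"
  have N: "card ?N = card (roots K f)" using card_roots_add[OF K, of f] f(3) by linarith
  have sub: "roots K f \<subseteq> f ` ?N" using f(2) by (simp add: sprouting_def)
  have le: "card (f ` ?N) \<le> card (roots K f)" using N K by (metis card_image_le finite_Diff)
  then have im: "f ` ?N = roots K f"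
    using sub K by (metis card_seteq finite_Diff finite_imageI)
  then have "inj_on f ?N" using N K by (intro eq_card_imp_inj_on) auto
  with im f show "f \<in> pairings K" by (auto simp: pairings_def bij_betw_def)
qed

lemma forest_sign_eq:
  assumes "finite K"
  shows "forest_sign K f = (- 1) ^ card (K - roots K f)"
proof -
  have "forest_sign K f = (\<Prod>a\<in>K - roots K f. - 1)"
    unfolding forest_sign_def using assms
    by (intro prod.mono_neutral_cong_right) (auto simp: roots_def)
  then show ?thesis by simp
qed

lemma forest_sign_abs [simp]: "finite K \<Longrightarrow> \<bar>forest_sign K f\<bar> = 1"
  by (simp add: forest_sign_eq power_abs)

lemma forest_sign_pairings:
  assumes K: "finite K" and f: "f \<in> pairings K" and g: "g \<in> pairings K"
  shows "forest_sign K f * forest_sign K g = 1"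
proof -
  have "card (K - roots K f) = card (K - roots K g)"
    using f g card_roots_add[OF K, of f] card_roots_add[OF K, of g] by (auto simp: pairings_eq[OF K])
  then show ?thesis by (simp add: forest_sign_eq[OF K] flip: power_mult_distrib)
qed

text \<open>The rising factorial that also counts permutations by their number of cycles: each vertex either is a
root, with weight \<open>x\<close>, or chooses one of the smaller vertices.\<close>

lemma sum_power_roots:
  fixes x :: real
  assumes K: "finite K"
  shows "(\<Sum>f\<in>forests K. x ^ card (roots K f)) = (\<Prod>a\<in>K. x + real (card {b \<in> K. b < a}))"
proof -
  have "x ^ card (roots K f) = (\<Prod>a\<in>K. if f a = a then x else 1)" for f
    using K by (simp add: roots_def prod.If_cases Int_def)
  then have "(\<Sum>f\<in>forests K. x ^ card (roots K f))
      = (\<Prod>a\<in>K. \<Sum>b\<in>{b \<in> K. b \<le> a}. if b = a then x else 1)"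
    unfolding forests_def using K by (subst prod_sum_PiE) auto
  also have "\<dots> = (\<Prod>a\<in>K. x + real (card {b \<in> K. b < a}))"
  proof (rule prod.cong[OF refl])
    fix a assume a: "a \<in> K"
    have "{b \<in> K. b \<le> a} = insert a {b \<in> K. b < a}" using a by auto
    then show "(\<Sum>b\<in>{b \<in> K. b \<le> a}. if b = a then x else 1) = x + real (card {b \<in> K. b < a})"
      using K by simp
  qed
  finally show ?thesis .
qed

lemma sum_power_roots_le:
  fixes x :: real
  assumes K: "finite K" and x: "0 \<le> x"
  shows "(\<Sum>f\<in>forests K. x ^ card (roots K f)) \<le> (x + real (card K)) ^ card K"
proof -
  have "(\<Prod>a\<in>K. x + real (card {b \<in> K. b < a})) \<le> (\<Prod>a\<in>K. x + real (card K))"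
    using K x by (intro prod_mono) (auto intro!: card_mono)
  then show ?thesis by (simp add: sum_power_roots[OF K])
qed

section \<open>The pairing sum as a Gaussian moment\<close>

fun pairing_count :: "nat \<Rightarrow> nat" where
  "pairing_count 0 = 1"
| "pairing_count (Suc 0) = 0"
| "pairing_count (Suc (Suc m)) = Suc m * pairing_count m"

text \<open>By Isserlis' theorem this is the moment of \<open>\<Prod>e\<in>K. x (i e)\<close> for independent standard Gaussian variables
\<open>x 0, \<dots>, x (n - 1)\<close>. The formula through multiplicities makes it manifestly invariant under
relabelling of \<open>K\<close>.\<close>

definition wick :: "nat \<Rightarrow> nat set \<Rightarrow> (nat \<Rightarrow> nat) \<Rightarrow> real" where
  "wick n K i = (\<Prod>v<n. real (pairing_count (card {e \<in> K. i e = v})))"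

lemma pairing_count_rec: "0 < m \<Longrightarrow> pairing_count m = (m - 1) * pairing_count (m - 2)"
  by (cases m rule: pairing_count.cases) (auto simp: numeral_2_eq_2)

text \<open>Pair the variable of \<open>a\<close> with each other occurrence of the same variable (Gaussian integration by parts).\<close>

lemma wick_rec:
  assumes K: "finite K" and a: "a \<in> K" "i a < n"
  shows "wick n K i = (\<Sum>l\<in>K - {a}. of_bool (i l = i a) * wick n (K - {a, l}) i)"
proof -
  define m where "m = card {e \<in> K. i e = i a}"
  define R where "R = (\<Prod>v\<in>{..<n} - {i a}. real (pairing_count (card {e \<in> K. i e = v})))"
  have m: "0 < m" using K a by (auto simp: m_def card_gt_0_iff)
  have "wick n (K - {a, l}) i = real (pairing_count (m - 2)) * R"
    if l: "l \<in> K - {a}" "i l = i a" for l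
  proof -
    have "{e \<in> K - {a, l}. i e = i a} = {e \<in> K. i e = i a} - {a, l}" by auto
    then have "card {e \<in> K - {a, l}. i e = i a} = m - 2"
      using K a l by (simp add: m_def card_Diff_subset)
    moreover have "{e \<in> K - {a, l}. i e = v} = {e \<in> K. i e = v}" if "v \<noteq> i a" for v
      using l that by auto
    ultimately show ?thesis
      unfolding wick_def R_def using a by (subst prod.remove[of _ "i a"]) auto
  qed
  then have "(\<Sum>l\<in>K - {a}. of_bool (i l = i a) * wick n (K - {a, l}) i)
      = (\<Sum>l\<in>K - {a}. of_bool (i l = i a) * (real (pairing_count (m - 2)) * R))"
    by (intro sum.cong) auto
  also have "\<dots> = real (card ({e \<in> K. i e = i a} - {a})) * (real (pairing_count (m - 2)) * R)"
    using K by (simp flip: sum_distrib_right) (auto simp: of_bool_def sum.If_cases intro!: arg_cong[where f = card])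
  also have "card ({e \<in> K. i e = i a} - {a}) = m - 1" using K a by (simp add: m_def)
  also have "real (m - 1) * (real (pairing_count (m - 2)) * R) = real (pairing_count m) * R"
    by (simp add: pairing_count_rec[OF m])
  also have "\<dots> = wick n K i"
    unfolding wick_def R_def m_def using a by (subst prod.remove[of _ "i a"]) auto
  finally show ?thesis by simp
qed

text \<open>The largest vertex of a pairing cannot be a root, because its partner would have to be larger. So
a pairing is determined by the partner \<open>l\<close> of the largest vertex and a pairing of the rest.\<close>

lemma pairings_split:
  assumes K: "finite K" "K \<noteq> {}"
  defines "a \<equiv> Max K"
  shows "bij_betw (\<lambda>(l, g). g(a := l, l := l)) (SIGMA l:K - {a}. pairings (K - {a, l})) (pairings K)"
proof (rule bij_betwI[where g = "\<lambda>f. (f a, restrict f (K - {a, f a}))"])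
  have aK: "a \<in> K" and max: "\<And>b. b \<in> K \<Longrightarrow> b \<le> a" using K by (auto simp: a_def)
  show "(\<lambda>(l, g). g(a := l, l := l)) \<in> (SIGMA l:K - {a}. pairings (K - {a, l})) \<rightarrow> pairings K"
  proof (rule funcsetI)
    fix p assume "p \<in> (SIGMA l:K - {a}. pairings (K - {a, l}))"
    then obtain l g where p: "p = (l, g)" and 1: "l \<in> K" "l \<noteq> a" "g \<in> pairings (K - {a, l})"
      by auto
    let ?f = "g(a := l, l := l)" and ?K' = "K - {a, l}"
    have g: "g \<in> forests ?K'" "bij_betw g (?K' - roots ?K' g) (roots ?K' g)"
      using 1 by (auto simp: pairings_def)
    have f: "?f \<in> forests K"
    proof -
      have "?f b \<in> {c \<in> K. c \<le> b}" if "b \<in> K" for b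
        using g(1) that 1 max by (auto simp: forests_def PiE_iff)
      moreover have "?f b = undefined" if "b \<notin> K" for b
        using g(1) that 1 aK by (auto simp: forests_def PiE_iff extensional_def)
      ultimately show ?thesis by (auto simp: forests_def PiE_iff extensional_def)
    qed
    have r: "roots K ?f = insert l (roots ?K' g)" and nr: "K - roots K ?f = insert a (?K' - roots ?K' g)"
      using 1 aK by (auto simp: roots_def)
    have "bij_betw ?f (?K' - roots ?K' g) (roots ?K' g)"
      using g(2) by (rule bij_betw_cong[THEN iffD1, rotated]) auto
    moreover have "l \<notin> roots ?K' g" "a \<notin> ?K' - roots ?K' g" by (auto simp: roots_def)
    moreover have "?f a = l" using 1 by auto
    ultimately have "bij_betw ?f (insert a (?K' - roots ?K' g)) (insert l (roots ?K' g))"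
      by (metis notIn_Un_bij_betw3 Un_insert_right sup_bot_right)
    then show "(case p of (l, g) \<Rightarrow> g(a := l, l := l)) \<in> pairings K"
      using f unfolding p pairings_def r[symmetric] nr[symmetric] by simp
  qed
  show "(\<lambda>f. (f a, restrict f (K - {a, f a}))) \<in> pairings K \<rightarrow> (SIGMA l:K - {a}. pairings (K - {a, l}))"
  proof (rule funcsetI)
    fix f assume "f \<in> pairings K"
    then have f: "f \<in> forests K" and bij: "bij_betw f (K - roots K f) (roots K f)"
      by (auto simp: pairings_def)
    have nr: "a \<notin> roots K f"
    proof
      assume "a \<in> roots K f"
      then have "a \<in> f ` (K - roots K f)" using bij by (simp add: bij_betw_def)
      then obtain c where "c \<in> K" "c \<notin> roots K f" "a = f c" by blast
      moreover from this have "f c \<le> c" using f by (auto simp: forests_def)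
      ultimately show False using max[of c] by (auto simp: roots_def)
    qed
    define l where "l = f a"
    have l: "l \<in> roots K f" using bij aK nr by (auto simp: bij_betw_def l_def)
    then have lK: "l \<in> K" "f l = l" "l \<noteq> a" using nr by (auto simp: roots_def)
    let ?K' = "K - {a, l}" and ?g = "restrict f (K - {a, l})"
    have only: "f c \<noteq> l" if "c \<in> K - roots K f" "c \<noteq> a" for c
      using bij that aK nr unfolding bij_betw_def inj_on_def l_def by blast
    have r: "roots ?K' ?g = roots K f - {l}" using nr by (auto simp: roots_def)
    have nr': "?K' - roots ?K' ?g = (K - roots K f) - {a}" using lK by (auto simp: roots_def)
    have "bij_betw f (K - roots K f - {a}) (roots K f - {l})"
    proof -
      have "f ` (K - roots K f - {a}) = f ` (K - roots K f) - f ` {a}"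
        using bij aK nr by (intro inj_on_image_set_diff[of f "K - roots K f"]) (auto simp: bij_betw_def)
      then show ?thesis using bij by (auto simp: bij_betw_def l_def intro: inj_on_subset)
    qed
    then have "bij_betw ?g (?K' - roots ?K' ?g) (roots ?K' ?g)"
      unfolding r nr'[unfolded r] by (rule bij_betw_cong[THEN iffD1, rotated]) (use lK in \<open>auto simp: roots_def\<close>)
    moreover have "?g \<in> forests ?K'"
    proof -
      have "f b \<in> {c \<in> ?K'. c \<le> b}" if b: "b \<in> ?K'" for b
      proof -
        have fb: "f b \<in> K" "f b \<le> b" using f b by (auto simp: forests_def)
        moreover have "f b \<noteq> a" using fb max b by (metis DiffD1 DiffD2 insertI1 le_antisym)
        moreover have "f b \<noteq> l" using only[of b] b by (auto simp: roots_def)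
        ultimately show ?thesis by auto
      qed
      then show ?thesis by (auto simp: forests_def)
    qed
    ultimately show "(f a, restrict f (K - {a, f a})) \<in> (SIGMA l:K - {a}. pairings (K - {a, l}))"
      using lK unfolding l_def[symmetric] by (auto simp: pairings_def)
  qed
  show "(\<lambda>f. (f a, restrict f (K - {a, f a}))) ((\<lambda>(l, g). g(a := l, l := l)) p) = p"
    if "p \<in> (SIGMA l:K - {a}. pairings (K - {a, l}))" for p
    using that by (cases p) (auto simp: pairings_def forests_def fun_eq_iff PiE_iff extensional_def restrict_def)
  show "(\<lambda>(l, g). g(a := l, l := l)) (f a, restrict f (K - {a, f a})) = f" if "f \<in> pairings K" for f
  proof -
    have "f a \<in> roots K f"
    proof (cases "a \<in> roots K f")
      case False
      then show ?thesis using that aK by (auto simp: pairings_def bij_betw_def)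
    qed (auto simp: roots_def)
    then show ?thesis
      using that by (auto simp: pairings_def forests_def fun_eq_iff PiE_iff extensional_def restrict_def roots_def)
  qed
qed

text \<open>Both sides satisfy the recursion that removes the largest vertex together with its partner.\<close>

lemma wick_eq_card_pairings:
  assumes "finite K" and "i \<in> K \<rightarrow> {..<n}"
  shows "wick n K i = real (card {f \<in> pairings K. compatible K f i})"
  using assms
proof (induction "card K" arbitrary: K rule: less_induct)
  case less
  show ?case
  proof (cases "K = {}")
    case True
    then show ?thesis
      by (simp add: wick_def pairings_def forests_def compatible_def roots_def bij_betw_def)
  next
    case False
    define a where "a = Max K"
    have aK: "a \<in> K" using less.prems False by (simp add: a_def)
    let ?c = "\<lambda>f. of_bool (compatible K f i) :: real"
    have "real (card {f \<in> pairings K. compatible K f i}) = (\<Sum>f\<in>pairings K. ?c f)"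
      using less.prems by (simp add: of_bool_def sum.If_cases Int_def)
    also have "\<dots> = (\<Sum>(l, g)\<in>(SIGMA l:K - {a}. pairings (K - {a, l})). ?c (g(a := l, l := l)))"
      using sum.reindex_bij_betw[OF pairings_split[OF less.prems(1) False], of ?c]
      by (simp add: a_def split_def)
    also have "\<dots> = (\<Sum>l\<in>K - {a}. \<Sum>g\<in>pairings (K - {a, l}). ?c (g(a := l, l := l)))"
      using less.prems by (subst sum.Sigma) auto
    also have "\<dots> = (\<Sum>l\<in>K - {a}. of_bool (i l = i a) * wick n (K - {a, l}) i)"
    proof (rule sum.cong[OF refl])
      fix l assume l: "l \<in> K - {a}"
      have "?c (g(a := l, l := l)) = of_bool (i l = i a) * of_bool (compatible (K - {a, l}) g i)" for g
        using l aK by (auto simp: compatible_def)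
      then have "(\<Sum>g\<in>pairings (K - {a, l}). ?c (g(a := l, l := l)))
          = of_bool (i l = i a) * real (card {f \<in> pairings (K - {a, l}). compatible (K - {a, l}) f i})"
        using less.prems by (simp flip: sum_distrib_left) (simp add: of_bool_def sum.If_cases Int_def)
      also have "real (card {f \<in> pairings (K - {a, l}). compatible (K - {a, l}) f i}) = wick n (K - {a, l}) i"
        using less.prems aK by (intro less.hyps[symmetric] psubset_card_mono) auto
      finally show "(\<Sum>g\<in>pairings (K - {a, l}). ?c (g(a := l, l := l)))
          = of_bool (i l = i a) * wick n (K - {a, l}) i" .
    qed
    also have "\<dots> = wick n K i"
      using less.prems aK by (intro wick_rec[symmetric]) auto
    finally show ?thesis by simp
  qed
qed

text \<open>The moment of order \<open>card K\<close> of the bilinear form \<open>x \<bullet> E y\<close> in independent standard Gaussian vectors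
\<open>x\<close> and \<open>y\<close>.\<close>

definition wick_sum :: "(nat \<Rightarrow> nat \<Rightarrow> real) \<Rightarrow> nat \<Rightarrow> nat set \<Rightarrow> real" where
  "wick_sum E n K = (\<Sum>i\<in>labellings n K. \<Sum>j\<in>labellings n K.
     wick n K i * wick n K j * (\<Prod>e\<in>K. E (i e) (j e)))"

lemma wick_sum_eq_pairing_sum:
  assumes K: "finite K"
  shows "wick_sum E n K = (\<Sum>f\<in>pairings K. \<Sum>g\<in>pairings K. edge_sum E n K f g)"
proof -
  let ?L = "labellings n K" and ?F = "pairings K"
  let ?P = "\<lambda>i j. \<Prod>e\<in>K. E (i e) (j e)"
  have ind: "wick n K i = (\<Sum>f\<in>?F. of_bool (compatible K f i))" if "i \<in> ?L" for i
    using K that by (subst wick_eq_card_pairings) (auto simp: labellings_def of_bool_def sum.If_cases Int_def)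
  have "wick_sum E n K = (\<Sum>i\<in>?L. \<Sum>j\<in>?L. \<Sum>f\<in>?F. \<Sum>g\<in>?F.
      of_bool (compatible K f i) * of_bool (compatible K g j) * ?P i j)"
    unfolding wick_sum_def
    by (intro sum.cong refl, simp only: ind, subst sum_product, simp only: sum_distrib_right)
  also have "\<dots> = (\<Sum>f\<in>?F. \<Sum>g\<in>?F. \<Sum>i\<in>?L. \<Sum>j\<in>?L.
      of_bool (compatible K f i) * of_bool (compatible K g j) * ?P i j)"
    by (rule sum_swap_pairs)
  also have "\<dots> = (\<Sum>f\<in>?F. \<Sum>g\<in>?F. edge_sum E n K f g)"
    using K unfolding edge_sum_def
    by (simp only: sum_filter_of_bool finite_labellings sum_distrib_left mult.assoc)
  finally show ?thesis by simp
qed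

text \<open>The same moment with \<open>B\<close> in place of \<open>E\<close> at the edge \<open>a\<close>. Such marked edges arise when paired edges are
contracted to one.\<close>

definition marked_wick_sum ::
  "(nat \<Rightarrow> nat \<Rightarrow> real) \<Rightarrow> nat \<Rightarrow> nat set \<Rightarrow> nat \<Rightarrow> (nat \<Rightarrow> nat \<Rightarrow> real) \<Rightarrow> real" where
  "marked_wick_sum E n K a B = (\<Sum>i\<in>labellings n K. \<Sum>j\<in>labellings n K.
     wick n K i * wick n K j * (B (i a) (j a) * (\<Prod>e\<in>K - {a}. E (i e) (j e))))"

lemma wick_sum_eq_marked:
  assumes "finite K" "a \<in> K"
  shows "wick_sum E n K = marked_wick_sum E n K a E"
  unfolding wick_sum_def marked_wick_sum_def using assms by (simp add: prod.remove)

lemma wick_cong: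
  assumes "\<And>e. e \<in> K \<Longrightarrow> i e = j e"
  shows "wick n K i = wick n K j"
proof -
  have "{e \<in> K. i e = v} = {e \<in> K. j e = v}" for v using assms by auto
  then show ?thesis by (simp only: wick_def)
qed

lemma wick_relabel:
  assumes "finite R" "l \<notin> R" "m \<notin> R"
  shows "wick n (insert l R) (r(l := x)) = wick n (insert m R) (r(m := x))"
proof -
  have *: "card {e \<in> insert l R. (r(l := x)) e = v} = of_bool (x = v) + card {e \<in> R. r e = v}"
    if "l \<notin> R" for l v
  proof -
    have "{e \<in> insert l R. (r(l := x)) e = v} = (if x = v then insert l {e \<in> R. r e = v} else {e \<in> R. r e = v})"
      using that by auto
    then show ?thesis using that assms(1) by simp
  qed
  show ?thesis unfolding wick_def by (simp only: *[OF assms(2)] *[OF assms(3)])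
qed

lemma sum_labellings_merge:
  fixes h :: "(nat \<Rightarrow> nat) \<Rightarrow> real"
  assumes "finite K" "a \<in> K" "l \<in> K" "a \<noteq> l"
  shows "(\<Sum>i\<in>labellings n K. of_bool (i l = i a) * h i)
       = (\<Sum>i\<in>labellings n (K - {a, l}). \<Sum>x<n. h (i(l := x, a := x)))"
proof -
  define R where "R = K - {a, l}"
  have R: "K = insert a (insert l R)" "finite R" "l \<notin> R" "a \<notin> insert l R"
    using assms by (auto simp: R_def)
  have "(\<Sum>i\<in>labellings n K. of_bool (i l = i a) * h i)
      = (\<Sum>x<n. \<Sum>y<n. \<Sum>i\<in>labellings n R. of_bool (y = x) * h (i(l := y, a := x)))"
    unfolding R(1) using R assms(4)
    by (simp add: sum_labellings_insert del: sum_of_bool_mult_eq sum_mult_of_bool_eq)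
  also have "\<dots> = (\<Sum>x<n. \<Sum>i\<in>labellings n R. \<Sum>y<n. of_bool (y = x) * h (i(l := y, a := x)))"
    by (rule sum.cong[OF refl], rule sum.swap)
  also have "\<dots> = (\<Sum>x<n. \<Sum>i\<in>labellings n R. h (i(l := x, a := x)))"
  proof (intro sum.cong refl)
    fix x i assume x: "x \<in> {..<n}"
    have "(\<Sum>y<n. of_bool (y = x) * h (i(l := y, a := x)))
        = (\<Sum>y<n. if y = x then h (i(l := x, a := x)) else 0)"
      by (rule sum.cong) auto
    then show "(\<Sum>y<n. of_bool (y = x) * h (i(l := y, a := x))) = h (i(l := x, a := x))"
      using x by simp
  qed
  also have "\<dots> = (\<Sum>i\<in>labellings n R. \<Sum>x<n. h (i(l := x, a := x)))"
    by (rule sum.swap)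
  finally show ?thesis unfolding R_def .
qed

text \<open>Integration by parts in the row variable of the marked edge \<open>a\<close> pairs it with an edge \<open>l\<close>; the two
edges merge into one with matrix \<open>P = B\<^sup>T E\<close> whose ends are both column variables. Integrate by parts
in the first of them: it is paired either with the other end, which closes a cycle and
contributes the trace of \<open>P\<close>, or with the column end of an edge \<open>m\<close>, and the three edges merge into
one marked edge with matrix \<open>B' = E B\<^sup>T E\<close>.\<close>

lemma marked_wick_sum_rec:
  fixes E B :: "nat \<Rightarrow> nat \<Rightarrow> real" and n :: nat
  assumes K: "finite K" and a: "a \<in> K"
  defines "P \<equiv> \<lambda>y z. \<Sum>x<n. B x y * E x z"
  defines "B' \<equiv> \<lambda>u v. \<Sum>y<n. E u y * P y v"
  shows "marked_wick_sum E n K a B = (\<Sum>l\<in>K - {a}. (\<Sum>y<n. P y y) * wick_sum E n (K - {a, l})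
           + (\<Sum>m\<in>K - {a, l}. marked_wick_sum E n (K - {a, l}) m B'))"
proof -
  let ?L = "labellings n"
  have aL: "i a < n" if "i \<in> ?L K" for i using that a by (auto simp: labellings_def)
  have rec: "wick n K i = (\<Sum>l\<in>K - {a}. of_bool (i l = i a) * wick n (K - {a, l}) i)"
    if "i \<in> ?L K" for i
    by (rule wick_rec) (use K a aL[OF that] in auto)
  have "marked_wick_sum E n K a B = (\<Sum>j\<in>?L K. \<Sum>i\<in>?L K. \<Sum>l\<in>K - {a}.
      of_bool (i l = i a) * (wick n (K - {a, l}) i * wick n K j * (B (i a) (j a) * (\<Prod>e\<in>K - {a}. E (i e) (j e)))))"
    unfolding marked_wick_sum_def
  proof (subst sum.swap, intro sum.cong refl)
    fix i j assume i: "i \<in> ?L K"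
    show "wick n K i * wick n K j * (B (i a) (j a) * (\<Prod>e\<in>K - {a}. E (i e) (j e))) = (\<Sum>l\<in>K - {a}.
      of_bool (i l = i a) * (wick n (K - {a, l}) i * wick n K j * (B (i a) (j a) * (\<Prod>e\<in>K - {a}. E (i e) (j e)))))"
      by (simp only: rec[OF i] sum_distrib_right mult.assoc)
  qed
  also have "\<dots> = (\<Sum>l\<in>K - {a}. \<Sum>j\<in>?L K. \<Sum>i\<in>?L K.
      of_bool (i l = i a) * (wick n (K - {a, l}) i * wick n K j * (B (i a) (j a) * (\<Prod>e\<in>K - {a}. E (i e) (j e)))))"
  proof -
    have "(\<Sum>j\<in>?L K. \<Sum>i\<in>?L K. \<Sum>l\<in>K - {a}. h i j l) = (\<Sum>l\<in>K - {a}. \<Sum>j\<in>?L K. \<Sum>i\<in>?L K. h i j l)"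
      for h :: "(nat \<Rightarrow> nat) \<Rightarrow> (nat \<Rightarrow> nat) \<Rightarrow> nat \<Rightarrow> real"
    proof (rule trans)
      show "(\<Sum>j\<in>?L K. \<Sum>i\<in>?L K. \<Sum>l\<in>K - {a}. h i j l) = (\<Sum>j\<in>?L K. \<Sum>l\<in>K - {a}. \<Sum>i\<in>?L K. h i j l)"
        by (rule sum.cong[OF refl], rule sum.swap)
    qed (rule sum.swap)
    then show ?thesis .
  qed
  also have "\<dots> = (\<Sum>l\<in>K - {a}. (\<Sum>y<n. P y y) * wick_sum E n (K - {a, l})
           + (\<Sum>m\<in>K - {a, l}. marked_wick_sum E n (K - {a, l}) m B'))"
  proof (rule sum.cong[OF refl])
    fix l assume l: "l \<in> K - {a}"
    define R where "R = K - {a, l}"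
    have R: "finite R" "a \<notin> R" "l \<notin> R" "K - {a} = insert l R" "K = insert a (insert l R)" "a \<noteq> l"
      using K a l by (auto simp: R_def)
    have aux: "wick n R (i(l := x, a := y)) = wick n R i"
      "(\<Prod>e\<in>R. E ((i(l := x, a := y)) e) (j e)) = (\<Prod>e\<in>R. E (i e) (j e))"
      "(\<Prod>e\<in>R. E (i e) ((j(l := x, a := y)) e)) = (\<Prod>e\<in>R. E (i e) (j e))" for i j x y
      using R by (auto intro!: wick_cong prod.cong)
    have upd: "(i(l := x, a := x)) a = x" "(i(l := x, a := x)) l = x" for i :: "nat \<Rightarrow> nat" and x
      using R(6) by auto
    have merge: "(\<Sum>i\<in>?L K. of_bool (i l = i a) * h i) = (\<Sum>i\<in>?L R. \<Sum>x<n. h (i(l := x, a := x)))"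
      for h :: "(nat \<Rightarrow> nat) \<Rightarrow> real"
      using l a K R(6) unfolding R_def by (intro sum_labellings_merge) auto
    have 1: "(\<Sum>i\<in>?L K. of_bool (i l = i a) *
          (wick n R i * wick n K j * (B (i a) (j a) * (\<Prod>e\<in>K - {a}. E (i e) (j e)))))
        = (\<Sum>i\<in>?L R. wick n R i * wick n K j * (P (j a) (j l) * (\<Prod>e\<in>R. E (i e) (j e))))" for j
    proof -
      have "(\<Sum>i\<in>?L K. of_bool (i l = i a) *
          (wick n R i * wick n K j * (B (i a) (j a) * (\<Prod>e\<in>K - {a}. E (i e) (j e)))))
          = (\<Sum>i\<in>?L R. \<Sum>x<n. wick n R i * wick n K j * (B x (j a) * (E x (j l) * (\<Prod>e\<in>R. E (i e) (j e)))))"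
        by (simp only: merge R(4) aux upd prod.insert[OF R(1,3)])
      then show ?thesis by (simp add: P_def sum_distrib_left sum_distrib_right mult_ac)
    qed
    have 2: "(\<Sum>j\<in>?L K. of_bool (j l = j a) * (wick n R j * (P (j a) (j l) * (\<Prod>e\<in>R. E (i e) (j e)))))
        = (\<Sum>y<n. P y y) * (\<Sum>j\<in>?L R. wick n R j * (\<Prod>e\<in>R. E (i e) (j e)))" for i
    proof -
      have "(\<Sum>j\<in>?L K. of_bool (j l = j a) * (wick n R j * (P (j a) (j l) * (\<Prod>e\<in>R. E (i e) (j e)))))
        = (\<Sum>j\<in>?L R. \<Sum>y<n. wick n R j * (P y y * (\<Prod>e\<in>R. E (i e) (j e))))"
        by (simp only: merge aux(1,3) upd)
      also have "\<dots> = (\<Sum>j\<in>?L R. (\<Sum>y<n. P y y) * (wick n R j * (\<Prod>e\<in>R. E (i e) (j e))))"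
        unfolding sum_distrib_right by (intro sum.cong refl) (rule mult.left_commute)
      finally show ?thesis by (simp only: sum_distrib_left)
    qed
    have 3: "(\<Sum>j\<in>?L K. of_bool (j m = j a) * (wick n (K - {a, m}) j * (P (j a) (j l) * (\<Prod>e\<in>R. E (i e) (j e)))))
        = (\<Sum>j\<in>?L R. wick n R j * (B' (i m) (j m) * (\<Prod>e\<in>R - {m}. E (i e) (j e))))"
      if m: "m \<in> R" for i m
    proof -
      define S where "S = R - {m}"
      have S: "finite S" "m \<notin> S" "l \<notin> S" "a \<notin> S" "R = insert m S" "K - {a, m} = insert l S" "a \<noteq> m" "m \<noteq> l"
        using K a m l by (auto simp: S_def R_def)
      let ?q = "\<lambda>j. \<Prod>e\<in>S. E (i e) (j e)"
      have prodS: "?q (j(c := x)) = ?q j" if "c \<notin> S" for j c x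
        using that by (intro prod.cong) auto
      have "(\<Sum>j\<in>?L K. of_bool (j m = j a) * (wick n (K - {a, m}) j * (P (j a) (j l) * (\<Prod>e\<in>R. E (i e) (j e)))))
          = (\<Sum>j\<in>?L (insert l S). \<Sum>y<n. wick n (K - {a, m}) (j(m := y, a := y)) *
              (P ((j(m := y, a := y)) a) ((j(m := y, a := y)) l) * (\<Prod>e\<in>R. E (i e) ((j(m := y, a := y)) e))))"
        unfolding S(6)[symmetric] using m a K S(7) by (intro sum_labellings_merge) (auto simp: R_def)
      also have "\<dots> = (\<Sum>j\<in>?L (insert l S). wick n (insert l S) j * (B' (i m) (j l) * ?q j))"
      proof (rule sum.cong[OF refl])
        fix j
        have "wick n (K - {a, m}) (j(m := y, a := y)) *
              (P ((j(m := y, a := y)) a) ((j(m := y, a := y)) l) * (\<Prod>e\<in>R. E (i e) ((j(m := y, a := y)) e)))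
            = (wick n (insert l S) j * ?q j) * (E (i m) y * P y (j l))" for y
        proof -
          have "wick n (K - {a, m}) (j(m := y, a := y)) = wick n (insert l S) j"
            unfolding S(6) using S(2,4,7,8) R(6) by (intro wick_cong) auto
          moreover have "(\<Prod>e\<in>R. E (i e) ((j(m := y, a := y)) e)) = E (i m) y * ?q j"
            unfolding S(5) prod.insert[OF S(1,2)] prodS[OF S(4)] prodS[OF S(2)] using S(7) by simp
          moreover have "(j(m := y, a := y)) a = y" "(j(m := y, a := y)) l = j l"
            using S(8) R(6) by auto
          ultimately show ?thesis by (simp only: mult_ac)
        qed
        then have "(\<Sum>y<n. wick n (K - {a, m}) (j(m := y, a := y)) *
              (P ((j(m := y, a := y)) a) ((j(m := y, a := y)) l) * (\<Prod>e\<in>R. E (i e) ((j(m := y, a := y)) e))))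
            = (\<Sum>y<n. (wick n (insert l S) j * ?q j) * (E (i m) y * P y (j l)))"
          by (intro sum.cong refl)
        also have "\<dots> = (wick n (insert l S) j * ?q j) * B' (i m) (j l)"
          unfolding B'_def sum_distrib_left ..
        finally show "(\<Sum>y<n. wick n (K - {a, m}) (j(m := y, a := y)) *
              (P ((j(m := y, a := y)) a) ((j(m := y, a := y)) l) * (\<Prod>e\<in>R. E (i e) ((j(m := y, a := y)) e))))
            = wick n (insert l S) j * (B' (i m) (j l) * ?q j)"
          by (simp only: mult_ac)
      qed
      also have "\<dots> = (\<Sum>x<n. \<Sum>r\<in>?L S. wick n (insert l S) (r(l := x)) * (B' (i m) x * ?q r))"
        unfolding sum_labellings_insert[OF S(1,3)] by (simp only: prodS[OF S(3)] fun_upd_same)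
      \<comment> \<open>the merged edge has row index at m but column index at l; move the latter to m\<close>
      also have "\<dots> = (\<Sum>x<n. \<Sum>r\<in>?L S. wick n (insert m S) (r(m := x)) * (B' (i m) x * ?q r))"
        by (simp only: wick_relabel[OF S(1,3,2)])
      also have "\<dots> = (\<Sum>j\<in>?L (insert m S). wick n (insert m S) j * (B' (i m) (j m) * ?q j))"
        unfolding sum_labellings_insert[OF S(1,2)] by (simp only: prodS[OF S(2)] fun_upd_same)
      finally show ?thesis unfolding S_def[symmetric] S(5)[symmetric] .
    qed
    have "(\<Sum>j\<in>?L K. \<Sum>i\<in>?L K. of_bool (i l = i a) *
          (wick n R i * wick n K j * (B (i a) (j a) * (\<Prod>e\<in>K - {a}. E (i e) (j e)))))
        = (\<Sum>i\<in>?L R. wick n R i * (\<Sum>j\<in>?L K. wick n K j * (P (j a) (j l) * (\<Prod>e\<in>R. E (i e) (j e)))))"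
      by (simp only: 1) (subst sum.swap, simp only: sum_distrib_left mult.assoc)
    also have "\<dots> = (\<Sum>i\<in>?L R. wick n R i *
          ((\<Sum>j\<in>?L K. of_bool (j l = j a) * (wick n R j * (P (j a) (j l) * (\<Prod>e\<in>R. E (i e) (j e)))))
          + (\<Sum>m\<in>R. \<Sum>j\<in>?L K. of_bool (j m = j a) * (wick n (K - {a, m}) j * (P (j a) (j l) * (\<Prod>e\<in>R. E (i e) (j e)))))))"
    proof (intro sum.cong refl arg_cong2[where f = "(*)"])
      fix i
      have "wick n K j * z = of_bool (j l = j a) * (wick n R j * z)
          + (\<Sum>m\<in>R. of_bool (j m = j a) * (wick n (K - {a, m}) j * z))" if "j \<in> ?L K" for j z
        using R(1,3) unfolding rec[OF that] R(4)
        by (simp add: R_def[symmetric] distrib_right sum_distrib_right mult.assoc)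
      then show "(\<Sum>j\<in>?L K. wick n K j * (P (j a) (j l) * (\<Prod>e\<in>R. E (i e) (j e))))
          = (\<Sum>j\<in>?L K. of_bool (j l = j a) * (wick n R j * (P (j a) (j l) * (\<Prod>e\<in>R. E (i e) (j e)))))
          + (\<Sum>m\<in>R. \<Sum>j\<in>?L K. of_bool (j m = j a) * (wick n (K - {a, m}) j * (P (j a) (j l) * (\<Prod>e\<in>R. E (i e) (j e)))))"
        by (subst sum.swap) (simp only: sum.distrib[symmetric] cong: sum.cong)
    qed
    also have "\<dots> = (\<Sum>i\<in>?L R. wick n R i *
          ((\<Sum>y<n. P y y) * (\<Sum>j\<in>?L R. wick n R j * (\<Prod>e\<in>R. E (i e) (j e)))
          + (\<Sum>m\<in>R. \<Sum>j\<in>?L R. wick n R j * (B' (i m) (j m) * (\<Prod>e\<in>R - {m}. E (i e) (j e))))))"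
      by (simp only: 2 3 cong: sum.cong)
    also have "\<dots> = (\<Sum>y<n. P y y) * wick_sum E n R + (\<Sum>m\<in>R. marked_wick_sum E n R m B')"
    proof -
      have "(\<Sum>m\<in>R. marked_wick_sum E n R m B') = (\<Sum>i\<in>?L R. \<Sum>m\<in>R. \<Sum>j\<in>?L R.
          wick n R i * wick n R j * (B' (i m) (j m) * (\<Prod>e\<in>R - {m}. E (i e) (j e))))"
        unfolding marked_wick_sum_def by (rule sum.swap)
      then show ?thesis
        by (simp add: wick_sum_def distrib_left sum.distrib sum_distrib_left mult_ac)
    qed
    finally show "(\<Sum>j\<in>?L K. \<Sum>i\<in>?L K. of_bool (i l = i a) *
          (wick n (K - {a, l}) i * wick n K j * (B (i a) (j a) * (\<Prod>e\<in>K - {a}. E (i e) (j e)))))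
        = (\<Sum>y<n. P y y) * wick_sum E n (K - {a, l})
           + (\<Sum>m\<in>K - {a, l}. marked_wick_sum E n (K - {a, l}) m B')"
      unfolding R_def .
  qed
  finally show ?thesis .
qed

section \<open>Closed walks and the determinant\<close>

text \<open>The coefficients of \<open>exp (\<Sum>q. a q X\<^bsup>2q+2\<^esup> / (2q+2))\<close>, given by the recursion that the logarithmic
derivative yields.\<close>

function wick_coeff :: "(nat \<Rightarrow> real) \<Rightarrow> nat \<Rightarrow> real" where
  "wick_coeff a 0 = 1"
| "wick_coeff a (Suc k) = (\<Sum>q<Suc k div 2. a q * wick_coeff a (Suc k - 2 - 2 * q)) / real (Suc k)"
  by pat_completeness auto
termination by (relation "measure snd") auto

lemma wick_coeff_rec:
  "real k * wick_coeff a k = (\<Sum>q<k div 2. a q * wick_coeff a (k - 2 - 2 * q))"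
  by (cases k) simp_all

text \<open>The entries of \<open>E (E\<^sup>T E)\<^bsup>p\<^esup>\<close>. The recursion is the step \<open>B \<mapsto> E B\<^sup>T E\<close> of
\<open>marked_wick_sum_rec\<close>; it agrees with multiplication by \<open>E\<^sup>T E\<close> because that matrix is symmetric.\<close>

primrec alternating_power :: "(nat \<Rightarrow> nat \<Rightarrow> real) \<Rightarrow> nat \<Rightarrow> nat \<Rightarrow> nat \<Rightarrow> nat \<Rightarrow> real" where
  "alternating_power E n 0 = E"
| "alternating_power E n (Suc p) =
     (\<lambda>u v. \<Sum>y<n. E u y * (\<Sum>x<n. alternating_power E n p x y * E x v))"

definition closed_walks :: "(nat \<Rightarrow> nat \<Rightarrow> real) \<Rightarrow> nat \<Rightarrow> nat \<Rightarrow> real" where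
  "closed_walks E n p = (\<Sum>y<n. \<Sum>x<n. alternating_power E n p x y * E x y)"

text \<open>Unrolling \<open>marked_wick_sum_rec\<close> follows the cycle through the marked edge until it closes, and the
remaining edges again form a moment. The induction is on the number of edges and carries the value
of the marked sums for all powers \<open>p\<close> along.\<close>

lemma wick_sum_closed:
  assumes "finite K"
  shows "wick_sum E n K = fact (card K) * wick_coeff (closed_walks E n) (card K)"
proof -
  let ?d = "wick_coeff (closed_walks E n)" and ?a = "closed_walks E n"
  have *: "(\<forall>m\<in>K. \<forall>p. marked_wick_sum E n K m (alternating_power E n p) = fact (card K - 1) *
      (\<Sum>q<card K div 2. ?a (p + q) * ?d (card K - 2 - 2 * q)))
    \<and> wick_sum E n K = fact (card K) * ?d (card K)" if "finite K" for K
    using that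
  proof (induction "card K" arbitrary: K rule: less_induct)
    case less
    have marked: "marked_wick_sum E n K m (alternating_power E n p) = fact (card K - 1) *
      (\<Sum>q<card K div 2. ?a (p + q) * ?d (card K - 2 - 2 * q))" if m: "m \<in> K" for m p
    proof -
      define k where "k = card K"
      have cK: "card (K - {m}) = k - 1" using m less.prems by (simp add: k_def)
      have cl: "card (K - {m, l}) = k - 2" "k \<ge> 2" "finite (K - {m, l})" "card (K - {m, l}) < card K"
        if l: "l \<in> K - {m}" for l
      proof -
        have "card {m, l} \<le> card K" using l m less.prems by (intro card_mono) auto
        then show "k \<ge> 2" using l by (auto simp: k_def)
        show "card (K - {m, l}) = k - 2" using l m less.prems by (subst card_Diff_subset) (auto simp: k_def)
        then show "card (K - {m, l}) < card K" using \<open>k \<ge> 2\<close> by (simp add: k_def)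
      qed (use less.prems in auto)
      define t where "t = fact (k - 2) * (\<Sum>q<k div 2. ?a (p + q) * ?d (k - 2 - 2 * q))"
      have "marked_wick_sum E n K m (alternating_power E n p) = (\<Sum>l\<in>K - {m}. ?a p * wick_sum E n (K - {m, l})
           + (\<Sum>c\<in>K - {m, l}. marked_wick_sum E n (K - {m, l}) c (alternating_power E n (Suc p))))"
        unfolding marked_wick_sum_rec[OF less.prems m] closed_walks_def by simp
      also have "\<dots> = (\<Sum>l\<in>K - {m}. t)"
      proof (rule sum.cong[OF refl])
        fix l assume l: "l \<in> K - {m}"
        note c = cl[OF l]
        let ?s = "\<Sum>q<(k - 2) div 2. ?a (Suc p + q) * ?d (k - 2 - 2 - 2 * q)"
        have IH: "wick_sum E n (K - {m, l}) = fact (k - 2) * ?d (k - 2)"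
          "c \<in> K - {m, l} \<Longrightarrow> marked_wick_sum E n (K - {m, l}) c (alternating_power E n (Suc p)) = fact (k - 2 - 1) * ?s" for c
          using less.hyps[OF c(4) c(3)] unfolding c(1) by blast+
        have "(\<Sum>c\<in>K - {m, l}. marked_wick_sum E n (K - {m, l}) c (alternating_power E n (Suc p)))
            = (\<Sum>c\<in>K - {m, l}. fact (k - 2 - 1) * ?s)"
          by (rule sum.cong[OF refl], rule IH(2))
        also have "\<dots> = real (k - 2) * fact (k - 2 - 1) * ?s"
          by (simp only: sum_constant c(1) mult.assoc)
        also have "\<dots> = fact (k - 2) * ?s"
          by (cases "k = 2") (use c(2) in \<open>auto simp: fact_reduce[of "k - 2"]\<close>)
        finally have "?a p * wick_sum E n (K - {m, l})
           + (\<Sum>c\<in>K - {m, l}. marked_wick_sum E n (K - {m, l}) c (alternating_power E n (Suc p)))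
           = fact (k - 2) * (?a p * ?d (k - 2) + ?s)"
          by (simp only: IH(1) distrib_left mult.left_commute)
        also have "?a p * ?d (k - 2) + ?s = (\<Sum>q<Suc ((k - 2) div 2). ?a (p + q) * ?d (k - 2 - 2 * q))"
          by (subst sum.lessThan_Suc_shift) (simp add: eval_nat_numeral)
        also have "Suc ((k - 2) div 2) = k div 2" using c(2) by presburger
        finally show "?a p * wick_sum E n (K - {m, l})
           + (\<Sum>c\<in>K - {m, l}. marked_wick_sum E n (K - {m, l}) c (alternating_power E n (Suc p))) = t"
          unfolding t_def .
      qed
      also have "\<dots> = real (k - 1) * t" by (simp add: cK)
      also have "\<dots> = fact (k - 1) * (\<Sum>q<k div 2. ?a (p + q) * ?d (k - 2 - 2 * q))"
      proof (cases "k \<ge> 2")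
        case True
        then have "fact (k - 1) = real (k - 1) * fact (k - 2)"
          by (subst fact_reduce) (auto simp: numeral_2_eq_2)
        then show ?thesis by (simp add: t_def)
      qed (simp add: t_def)
      finally show ?thesis unfolding k_def .
    qed
    have "wick_sum E n K = fact (card K) * ?d (card K)"
    proof (cases "K = {}")
      case True
      then show ?thesis by (simp add: wick_sum_def labellings_def wick_def)
    next
      case False
      then obtain m where m: "m \<in> K" by blast
      have "wick_sum E n K = marked_wick_sum E n K m (alternating_power E n 0)"
        using wick_sum_eq_marked[OF less.prems m] by simp
      also have "\<dots> = fact (card K - 1) * (real (card K) * ?d (card K))"
        unfolding marked[OF m] wick_coeff_rec by simp
      also have "\<dots> = fact (card K) * ?d (card K)"
        using m less.prems by (subst (2) fact_reduce) (auto simp: card_gt_0_iff)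
      finally show ?thesis .
    qed
    with marked show ?case by blast
  qed
  then show ?thesis using assms by blast
qed

definition even_geometric :: "complex \<Rightarrow> complex fps" where
  "even_geometric e = Abs_fps (\<lambda>k. if even k \<and> 2 \<le> k then e ^ (k div 2) else 0)"

definition linear_factors :: "complex list \<Rightarrow> complex fps" where
  "linear_factors es = (\<Prod>e\<leftarrow>es. 1 - fps_const e * fps_X ^ 2)"

lemma even_geometric_eq:
  "(1 - fps_const e * fps_X ^ 2) * even_geometric e = fps_const e * fps_X ^ 2"
proof (rule fps_ext)
  fix k
  have "fps_nth ((1 - fps_const e * fps_X ^ 2) * even_geometric e) k
      = fps_nth (even_geometric e) k - e * fps_nth (fps_X ^ 2 * even_geometric e) k"
    by (simp add: left_diff_distrib mult.assoc)
  also have "\<dots> = fps_nth (fps_const e * fps_X ^ 2) k"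
  proof (cases "k < 4")
    case True
    then have "k = 0 \<or> k = 1 \<or> k = 2 \<or> k = 3" by auto
    then show ?thesis
      by (elim disjE) (simp_all add: even_geometric_def fps_X_power_mult_nth fps_X_power_nth)
  next
    case False
    then have k: "k = Suc (Suc (k - 2))" "2 \<le> k - 2" by auto
    have "k div 2 = Suc ((k - 2) div 2)" "even (k - 2) = even k" using k by presburger+
    then show ?thesis using k False
      by (auto simp: even_geometric_def fps_X_power_mult_nth fps_X_power_nth)
  qed
  finally show "fps_nth ((1 - fps_const e * fps_X ^ 2) * even_geometric e) k
      = fps_nth (fps_const e * fps_X ^ 2) k" .
qed

text \<open>Each \<open>even_geometric e\<close> is \<open>e X\<^sup>2 / (1 - e X\<^sup>2)\<close>, so this is the logarithmic derivative of
\<open>\<Prod>e. 1 - e X\<^sup>2\<close>.\<close>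

lemma deriv_linear_factors:
  "fps_X * fps_deriv (linear_factors es) = - 2 * linear_factors es * (\<Sum>e\<leftarrow>es. even_geometric e)"
proof (induction es)
  case Nil
  then show ?case by (simp add: linear_factors_def)
next
  case (Cons e es)
  let ?u = "1 - fps_const e * fps_X ^ 2" and ?D = "linear_factors es"
  let ?A = "\<Sum>e\<leftarrow>es. even_geometric e"
  have D: "linear_factors (e # es) = ?u * ?D" by (simp add: linear_factors_def)
  have "fps_X * fps_deriv ?u = - 2 * (fps_const e * fps_X ^ 2)"
    by (simp add: fps_deriv_power power2_eq_square algebra_simps)
  also have "\<dots> = - 2 * (?u * even_geometric e)" by (simp only: even_geometric_eq)
  finally have u: "fps_X * fps_deriv ?u = - 2 * (?u * even_geometric e)" .
  have "fps_X * fps_deriv (linear_factors (e # es))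
      = (fps_X * fps_deriv ?u) * ?D + ?u * (fps_X * fps_deriv ?D)"
    unfolding D fps_deriv_mult by (simp only: algebra_simps)
  also have "\<dots> = - 2 * linear_factors (e # es) * (even_geometric e + ?A)"
    unfolding u Cons.IH D by (simp only: algebra_simps)
  finally show ?case by simp
qed

text \<open>Let \<open>D\<close> be the product of the factors \<open>1 - e X\<^sup>2\<close> and \<open>A\<close> the sum of the power sums times \<open>X\<^bsup>2q+2\<^esup>\<close>.
Then \<open>X g' = g A\<close> and \<open>X D' = - 2 D A\<close>, so that \<open>g\<^sup>2 D\<close> has derivative zero and equals its constant
coefficient.\<close>

lemma wick_coeff_fps:
  assumes a: "\<And>q. complex_of_real (a q) = (\<Sum>e\<leftarrow>es. e ^ Suc q)"
  defines "g \<equiv> Abs_fps (\<lambda>k. complex_of_real (wick_coeff a k))"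
  shows "g * g * linear_factors es = 1"
proof -
  let ?D = "linear_factors es" and ?A = "\<Sum>e\<leftarrow>es. even_geometric e"
  have A: "fps_nth ?A k = (if even k \<and> 2 \<le> k then complex_of_real (a (k div 2 - 1)) else 0)" for k
  proof -
    have "fps_nth ?A k = (\<Sum>e\<leftarrow>es. fps_nth (even_geometric e) k)" by (induction es) simp_all
    also have "\<dots> = (if even k \<and> 2 \<le> k then complex_of_real (a (k div 2 - 1)) else 0)"
      unfolding a even_geometric_def by (auto simp: Suc_diff_Suc simp del: power_Suc)
    finally show ?thesis .
  qed
  have g: "fps_X * fps_deriv g = g * ?A"
  proof (rule fps_ext)
    fix k
    have "fps_nth (fps_X * fps_deriv g) k = of_nat k * complex_of_real (wick_coeff a k)"
      by (cases k) (simp_all add: g_def)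
    also have "\<dots> = complex_of_real (real k * wick_coeff a k)" by simp
    also have "\<dots> = (\<Sum>q<k div 2. complex_of_real (a q * wick_coeff a (k - 2 - 2 * q)))"
      unfolding wick_coeff_rec by simp
    also have "\<dots> = (\<Sum>i\<in>(\<lambda>q. 2 * Suc q) ` {..<k div 2}. fps_nth ?A i * fps_nth g (k - i))"
      by (subst sum.reindex) (auto simp: inj_on_def A g_def intro!: sum.cong)
    also have "\<dots> = (\<Sum>i=0..k. fps_nth ?A i * fps_nth g (k - i))"
    proof (rule sum.mono_neutral_left)
      show "\<forall>i\<in>{0..k} - (\<lambda>q. 2 * Suc q) ` {..<k div 2}. fps_nth ?A i * fps_nth g (k - i) = 0"
      proof (intro ballI)
        fix i assume i: "i \<in> {0..k} - (\<lambda>q. 2 * Suc q) ` {..<k div 2}"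
        have "\<not> (even i \<and> 2 \<le> i)"
        proof
          assume "even i \<and> 2 \<le> i"
          then have "i = 2 * Suc (i div 2 - 1)" "i div 2 - 1 < k div 2" using i by auto
          then show False using i by blast
        qed
        then show "fps_nth ?A i * fps_nth g (k - i) = 0" unfolding A by auto
      qed
    qed auto
    also have "\<dots> = fps_nth (g * ?A) k" by (subst mult.commute) (simp add: fps_mult_nth)
    finally show "fps_nth (fps_X * fps_deriv g) k = fps_nth (g * ?A) k" .
  qed
  have "fps_X * fps_deriv (g * g * ?D) = 2 * g * ?D * (fps_X * fps_deriv g) + g * g * (fps_X * fps_deriv ?D)"
    unfolding fps_deriv_mult by (simp add: algebra_simps)
  also have "\<dots> = 0" unfolding g deriv_linear_factors by (simp add: algebra_simps)
  finally have "fps_deriv (g * g * ?D) = 0" by simp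
  then have "g * g * ?D = fps_const (fps_nth (g * g * ?D) 0)" by (simp only: fps_deriv_eq_0_iff)
  moreover have "fps_nth ?D 0 = 1" unfolding linear_factors_def by (induction es) simp_all
  moreover have "fps_nth g 0 = 1" by (simp add: g_def)
  ultimately show ?thesis by simp
qed

text \<open>Evaluation at \<open>X = 1\<close>, one factor \<open>1 - e X\<^sup>2\<close> at a time, so that only shifts of a convergent series occur.\<close>

lemma sums_linear_factors:
  assumes "fps_nth f sums s"
  shows "fps_nth (f * linear_factors es) sums (s * (\<Prod>e\<leftarrow>es. 1 - e))"
  using assms
proof (induction es arbitrary: f s)
  case Nil
  then show ?case by (simp add: linear_factors_def)
next
  case (Cons e es)
  let ?f = "f * (1 - fps_const e * fps_X ^ 2)"
  have nth: "fps_nth ?f k = fps_nth f k - e * (if k < 2 then 0 else fps_nth f (k - 2))" for k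
    by (simp add: right_diff_distrib mult.left_commute[of f] fps_X_power_mult_right_nth)
  have "(\<lambda>k. fps_nth f (Suc (Suc k) - 2)) sums s" using Cons.prems by simp
  then have "(\<lambda>k. if k < 2 then 0 else fps_nth f (k - 2)) sums s"
    by (subst sums_iff_shift'[where n = 2, symmetric]) (auto simp: numeral_2_eq_2)
  then have "fps_nth ?f sums (s - e * s)"
    unfolding nth using Cons.prems by (intro sums_diff sums_mult)
  from Cons.IH[OF this] show ?case
    by (simp add: linear_factors_def mult.assoc algebra_simps)
qed

lemma wick_coeff_sum_squared:
  assumes a: "\<And>q. complex_of_real (a q) = (\<Sum>e\<leftarrow>es. e ^ Suc q)"
    and sm: "summable (\<lambda>k. \<bar>wick_coeff a k\<bar>)"
  shows "complex_of_real ((\<Sum>k. wick_coeff a k)\<^sup>2) * (\<Prod>e\<leftarrow>es. 1 - e) = 1"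
proof -
  define g where "g = Abs_fps (\<lambda>k. complex_of_real (wick_coeff a k))"
  define G where "G = (\<Sum>k. wick_coeff a k)"
  have "(\<lambda>k. wick_coeff a k) sums G" unfolding G_def
    using sm by (intro summable_sums) (rule summable_rabs_cancel)
  moreover have "fps_nth g = (\<lambda>k. complex_of_real (wick_coeff a k))" by (simp add: g_def fun_eq_iff)
  ultimately have gs: "fps_nth g sums complex_of_real G" by (simp only: sums_of_real)
  have gn: "summable (\<lambda>k. norm (fps_nth g k))" using sm by (simp add: g_def)
  have "fps_nth (g * g) sums (complex_of_real G * complex_of_real G)"
  proof -
    have "fps_nth (g * g) = (\<lambda>k. \<Sum>i\<le>k. fps_nth g i * fps_nth g (k - i))"
      by (simp add: fun_eq_iff fps_mult_nth atLeast0AtMost)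
    then show ?thesis using Cauchy_product_sums[OF gn gn] sums_unique[OF gs] by simp
  qed
  from sums_linear_factors[OF this]
  have "fps_nth (g * g * linear_factors es) sums (complex_of_real G * complex_of_real G * (\<Prod>e\<leftarrow>es. 1 - e))" .
  moreover have "g * g * linear_factors es = 1" unfolding g_def by (rule wick_coeff_fps[OF a])
  moreover have "fps_nth (1 :: complex fps) sums 1"
  proof -
    have "fps_nth (1 :: complex fps) = (\<lambda>k. if k = 0 then 1 else 0)" by (simp add: fun_eq_iff)
    then show ?thesis using sums_single[of 0 "\<lambda>_. 1 :: complex"] by simp
  qed
  ultimately show ?thesis
    using sums_unique2 by (force simp: G_def power2_eq_square)
qed

lemma diag_upper_triangular_pow:
  fixes T :: "'a::comm_semiring_1 mat"
  assumes T: "T \<in> carrier_mat n n" and ut: "upper_triangular T"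
  shows "(\<forall>i<n. \<forall>j<i. (T ^\<^sub>m k) $$ (i, j) = 0) \<and> (\<forall>i<n. (T ^\<^sub>m k) $$ (i, i) = (T $$ (i, i)) ^ k)"
proof (induction k)
  case 0
  then show ?case using T by auto
next
  case (Suc k)
  let ?P = "T ^\<^sub>m k"
  have P: "?P \<in> carrier_mat n n" using T by simp
  have T0: "T $$ (i, j) = 0" if "i < n" "j < i" for i j using ut T that by auto
  have entry: "(T ^\<^sub>m Suc k) $$ (i, j) = (\<Sum>c<n. ?P $$ (i, c) * T $$ (c, j))" if "i < n" "j < n" for i j
    using that T P by (simp add: scalar_prod_def atLeast0LessThan)
  have "(T ^\<^sub>m Suc k) $$ (i, j) = 0" if "i < n" "j < i" for i j
  proof -
    have "?P $$ (i, c) * T $$ (c, j) = 0" if c: "c < n" for c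
      using Suc.IH T0[of c j] \<open>i < n\<close> \<open>j < i\<close> c by (cases "c < i") auto
    then show ?thesis using that by (subst entry) auto
  qed
  moreover have "(T ^\<^sub>m Suc k) $$ (i, i) = (T $$ (i, i)) ^ Suc k" if i: "i < n" for i
  proof -
    have "?P $$ (i, c) * T $$ (c, i) = (if c = i then (T $$ (i, i)) ^ Suc k else 0)" if c: "c < n" for c
      using Suc.IH T0[of c i] i c by (cases c i rule: linorder_cases) (auto simp: mult.commute)
    then show ?thesis using i by (subst entry) auto
  qed
  ultimately show ?case by blast
qed

lemma pow_mat_Suc_left:
  assumes A: "A \<in> carrier_mat n n"
  shows "A ^\<^sub>m Suc k = A * A ^\<^sub>m k"
proof (induction k)
  case (Suc k)
  have "A ^\<^sub>m Suc (Suc k) = (A * A ^\<^sub>m k) * A" using Suc by simp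
  also have "\<dots> = A * (A ^\<^sub>m k * A)"
    using A by (intro assoc_mult_mat[of _ n n _ n _ n]) auto
  finally show ?case by simp
qed (use A in simp)

definition mat_trace :: "'a::comm_monoid_add mat \<Rightarrow> 'a" where
  "mat_trace A = (\<Sum>i<dim_row A. A $$ (i, i))"

lemma mat_trace_mult_commute:
  fixes A B :: "'a::comm_semiring_0 mat"
  assumes "A \<in> carrier_mat n n" "B \<in> carrier_mat n n"
  shows "mat_trace (A * B) = mat_trace (B * A)"
proof -
  have "mat_trace (A * B) = (\<Sum>i<n. \<Sum>c<n. A $$ (i, c) * B $$ (c, i))"
    using assms by (auto simp: mat_trace_def scalar_prod_def atLeast0LessThan intro!: sum.cong)
  also have "\<dots> = (\<Sum>c<n. \<Sum>i<n. A $$ (i, c) * B $$ (c, i))" by (rule sum.swap)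
  also have "\<dots> = mat_trace (B * A)"
    using assms by (auto simp: mat_trace_def scalar_prod_def atLeast0LessThan mult.commute intro!: sum.cong)
  finally show ?thesis .
qed

text \<open>By Schur's theorem \<open>A\<close> is similar to a triangular matrix, whose powers have the powers of the
eigenvalues on the diagonal.\<close>

lemma eigenvalues_trace_det:
  fixes A :: "complex mat"
  assumes A: "A \<in> carrier_mat n n"
  obtains es where "\<And>k. mat_trace (A ^\<^sub>m k) = (\<Sum>e\<leftarrow>es. e ^ k)"
    and "Determinant.det (1\<^sub>m n - A) = (\<Prod>e\<leftarrow>es. 1 - e)"
proof -
  obtain es where es: "char_poly A = (\<Prod>e\<leftarrow>es. [:- e, 1:])"
    using char_poly_factorized[OF A] by blast
  obtain T P Q where "schur_decomposition A es = (T, P, Q)" by (cases "schur_decomposition A es")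
  from schur_decomposition[OF A es this]
  have wit: "similar_mat_wit A T P Q" and ut: "upper_triangular T" and diag: "diag_mat T = es" by auto
  from similar_mat_witD2[OF A wit]
  have T: "T \<in> carrier_mat n n" and P: "P \<in> carrier_mat n n" and Q: "Q \<in> carrier_mat n n"
    and QP: "Q * P = 1\<^sub>m n" by auto
  have "mat_trace (A ^\<^sub>m k) = (\<Sum>e\<leftarrow>es. e ^ k)" for k
  proof -
    have Tk: "T ^\<^sub>m k \<in> carrier_mat n n" using T by simp
    have "mat_trace (A ^\<^sub>m k) = mat_trace (P * (T ^\<^sub>m k * Q))"
      using similar_mat_wit_pow_id[OF wit, of k] P Q Tk by (simp add: assoc_mult_mat[of _ n n _ n _ n])
    also have "\<dots> = mat_trace (T ^\<^sub>m k * Q * P)"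
      using P Q Tk by (intro mat_trace_mult_commute) auto
    also have "T ^\<^sub>m k * Q * P = T ^\<^sub>m k"
      using P Q Tk QP right_mult_one_mat[OF Tk] by (simp add: assoc_mult_mat[of _ n n _ n _ n])
    also have "mat_trace (T ^\<^sub>m k) = (\<Sum>i<n. (T $$ (i, i)) ^ k)"
      using diag_upper_triangular_pow[OF T ut, of k] T by (auto simp: mat_trace_def intro!: sum.cong)
    also have "\<dots> = (\<Sum>e\<leftarrow>es. e ^ k)"
      using T unfolding diag[symmetric] by (simp add: diag_mat_def interv_sum_list_conv_sum_set_nat atLeast0LessThan o_def)
    finally show ?thesis .
  qed
  moreover have "Determinant.det (1\<^sub>m n - A) = (\<Prod>e\<leftarrow>es. 1 - e)"
  proof -
    have "- char_matrix A 1 = 1\<^sub>m n - A" using A by (auto simp: char_matrix_def)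
    then have "Determinant.det (1\<^sub>m n - A) = poly (char_poly A) 1"
      using char_poly_matrix[OF A, of 1] by simp
    also have "\<dots> = (\<Prod>e\<leftarrow>es. 1 - e)"
      unfolding es by (induction es) (simp_all add: algebra_simps)
    finally show ?thesis .
  qed
  ultimately show ?thesis by (rule that)
qed

lemma alternating_power_eq:
  assumes E: "E \<in> carrier_mat n n" and u: "u < n" and v: "v < n"
  shows "alternating_power (\<lambda>i j. E $$ (i, j)) n p u v = (E * (transpose_mat E * E) ^\<^sub>m p) $$ (u, v)"
  using u v
proof (induction p arbitrary: u v)
  case 0
  then show ?case using E by simp
next
  case (Suc p)
  let ?M = "transpose_mat E * E"
  have M: "?M \<in> carrier_mat n n" using E by simp
  have Mp: "?M ^\<^sub>m p \<in> carrier_mat n n" using M by simp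
  have sym: "transpose_mat (?M ^\<^sub>m q) = ?M ^\<^sub>m q" for q
  proof (induction q)
    case (Suc q)
    have Mq: "?M ^\<^sub>m q \<in> carrier_mat n n" using M by simp
    have "transpose_mat (?M ^\<^sub>m Suc q) = transpose_mat ?M * transpose_mat (?M ^\<^sub>m q)"
      using M Mq by (simp add: transpose_mult[of _ n n _ n])
    also have "transpose_mat ?M = ?M" using E by (simp add: transpose_mult[of _ n n _ n])
    also have "?M * transpose_mat (?M ^\<^sub>m q) = ?M ^\<^sub>m Suc q"
      unfolding Suc.IH using pow_mat_Suc_left[OF M] by simp
    finally show ?case .
  qed (use E in simp)
  have "alternating_power (\<lambda>i j. E $$ (i, j)) n (Suc p) u v
      = (\<Sum>y<n. E $$ (u, y) * (\<Sum>x<n. (E * ?M ^\<^sub>m p) $$ (x, y) * E $$ (x, v)))"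
    using Suc by simp
  also have "\<dots> = (E * (transpose_mat (E * ?M ^\<^sub>m p) * E)) $$ (u, v)"
    using E Mp Suc.prems by (auto simp: scalar_prod_def atLeast0LessThan intro!: sum.cong)
  also have "transpose_mat (E * ?M ^\<^sub>m p) * E = ?M ^\<^sub>m Suc p"
    using E Mp by (simp add: transpose_mult[of _ n n _ n] sym assoc_mult_mat[of _ n n _ n _ n])
  finally show ?case .
qed

lemma closed_walks_eq_trace:
  assumes E: "E \<in> carrier_mat n n"
  shows "closed_walks (\<lambda>i j. E $$ (i, j)) n p = mat_trace ((transpose_mat E * E) ^\<^sub>m Suc p)"
proof -
  let ?M = "transpose_mat E * E"
  have M: "?M \<in> carrier_mat n n" using E by simp
  have Mp: "?M ^\<^sub>m p \<in> carrier_mat n n" using M by simp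
  have "closed_walks (\<lambda>i j. E $$ (i, j)) n p
      = (\<Sum>y<n. \<Sum>x<n. (E * ?M ^\<^sub>m p) $$ (x, y) * E $$ (x, y))"
    unfolding closed_walks_def using E by (intro sum.cong refl) (simp add: alternating_power_eq)
  also have "\<dots> = mat_trace (transpose_mat E * (E * ?M ^\<^sub>m p))"
    unfolding mat_trace_def using E Mp
    by (auto simp: scalar_prod_def atLeast0LessThan mult.commute intro!: sum.cong)
  also have "transpose_mat E * (E * ?M ^\<^sub>m p) = ?M * ?M ^\<^sub>m p"
    using E Mp by (simp add: assoc_mult_mat[of _ n n _ n _ n])
  also have "\<dots> = ?M ^\<^sub>m Suc p" using pow_mat_Suc_left[OF M] by simp
  finally show ?thesis .
qed

text \<open>The algebraic form of the Gaussian integral: the expectation of \<open>exp (x \<bullet> E y)\<close> is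
\<open>det (I - E\<^sup>T E)\<^bsup>-1/2\<^esup>\<close>.\<close>

theorem wick_series_squared_det:
  assumes E: "E \<in> carrier_mat n n"
    and sm: "summable (\<lambda>k. \<bar>wick_sum (\<lambda>i j. E $$ (i, j)) n {..<k} / fact k\<bar>)"
  shows "(\<Sum>k. wick_sum (\<lambda>i j. E $$ (i, j)) n {..<k} / fact k)\<^sup>2
           * Determinant.det (1\<^sub>m n - transpose_mat E * E) = 1"
proof -
  let ?a = "closed_walks (\<lambda>i j. E $$ (i, j)) n"
  let ?M = "transpose_mat E * E" and ?h = "map_mat complex_of_real"
  have M: "?M \<in> carrier_mat n n" using E by simp
  have c: "wick_sum (\<lambda>i j. E $$ (i, j)) n {..<k} / fact k = wick_coeff ?a k" for k
    using wick_sum_closed[of "{..<k}"] by simp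
  obtain es where tr: "\<And>k. mat_trace (?h ?M ^\<^sub>m k) = (\<Sum>e\<leftarrow>es. e ^ k)"
    and det: "Determinant.det (1\<^sub>m n - ?h ?M) = (\<Prod>e\<leftarrow>es. 1 - e)"
    using eigenvalues_trace_det[of "?h ?M" n] M by auto
  have "complex_of_real (?a q) = (\<Sum>e\<leftarrow>es. e ^ Suc q)" for q
  proof -
    have "complex_of_real (?a q) = mat_trace (?h (?M ^\<^sub>m Suc q))"
      unfolding closed_walks_eq_trace[OF E] mat_trace_def using M by simp
    also have "?h (?M ^\<^sub>m Suc q) = ?h ?M ^\<^sub>m Suc q" by (rule of_real_hom.mat_hom_pow[OF M])
    finally show ?thesis unfolding tr .
  qed
  from wick_coeff_sum_squared[OF this] sm
  have "complex_of_real ((\<Sum>k. wick_coeff ?a k)\<^sup>2) * Determinant.det (1\<^sub>m n - ?h ?M) = 1"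
    unfolding c det by simp
  also have "1\<^sub>m n - ?h ?M = ?h (1\<^sub>m n - ?M)"
    by (rule eq_matI) (use M in auto)
  also have "Determinant.det \<dots> = complex_of_real (Determinant.det (1\<^sub>m n - ?M))" by simp
  finally show ?thesis unfolding c
    by (metis of_real_1 of_real_eq_iff of_real_mult)
qed

section \<open>The permanent as a sum over partial matchings\<close>

text \<open>Composing with the transposition of \<open>a = i e\<close> and \<open>b = j e\<close> turns the requirement \<open>\<pi> a = b\<close> into
\<open>\<pi> a = a\<close>, and \<open>a\<close> can be removed from \<open>S\<close>.\<close>

lemma card_permutes_prescribed:
  assumes "finite K" "finite S" "inj_on i K" "inj_on j K" "i ` K \<subseteq> S" "j ` K \<subseteq> S"
  shows "card {\<pi>. \<pi> permutes S \<and> (\<forall>e\<in>K. \<pi> (i e) = j e)} = fact (card S - card K)"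
  using assms
proof (induction K arbitrary: S j rule: finite_induct)
  case empty
  then show ?case by (simp add: card_permutations)
next
  case (insert e K)
  define a b where "a = i e" and "b = j e"
  let ?\<tau> = "transpose a b"
  let ?X = "{\<pi>. \<pi> permutes S \<and> (\<forall>e'\<in>insert e K. \<pi> (i e') = j e')}"
  let ?Y = "{\<pi>. \<pi> permutes (S - {a}) \<and> (\<forall>e'\<in>K. \<pi> (i e') = (?\<tau> \<circ> j) e')}"
  have ab: "a \<in> S" "b \<in> S" using insert.prems by (auto simp: a_def b_def)
  have \<tau>: "?\<tau> permutes S" using ab by (rule permutes_swap_id)
  have "bij_betw (\<lambda>\<pi>. ?\<tau> \<circ> \<pi>) ?X ?Y"
  proof (rule bij_betwI[where g = "\<lambda>\<pi>. ?\<tau> \<circ> \<pi>"])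
    show "(\<lambda>\<pi>. ?\<tau> \<circ> \<pi>) \<in> ?X \<rightarrow> ?Y"
    proof (rule funcsetI)
      fix \<pi> assume "\<pi> \<in> ?X"
      then have \<pi>: "\<pi> permutes S" "\<pi> a = b" "\<forall>e'\<in>K. \<pi> (i e') = j e'" by (auto simp: a_def b_def)
      have "?\<tau> \<circ> \<pi> permutes S" using \<pi>(1) \<tau> by (rule permutes_compose)
      then have "?\<tau> \<circ> \<pi> permutes (S - {a})"
        by (rule permutes_superset) (use \<pi>(2) in auto)
      then show "?\<tau> \<circ> \<pi> \<in> ?Y" using \<pi>(3) by auto
    qed
    show "(\<lambda>\<pi>. ?\<tau> \<circ> \<pi>) \<in> ?Y \<rightarrow> ?X"
    proof (rule funcsetI)
      fix \<pi> assume "\<pi> \<in> ?Y"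
      then have \<pi>: "\<pi> permutes (S - {a})" "\<forall>e'\<in>K. \<pi> (i e') = ?\<tau> (j e')" by auto
      have "?\<tau> \<circ> \<pi> permutes S"
        using permutes_subset[OF \<pi>(1)] \<tau> by (intro permutes_compose) auto
      moreover have "\<pi> a = a" using \<pi>(1) by (auto simp: permutes_def)
      ultimately show "?\<tau> \<circ> \<pi> \<in> ?X" using \<pi>(2) by (auto simp: a_def b_def)
    qed
  qed (auto simp: fun_eq_iff)
  then have "card ?X = card ?Y" by (rule bij_betw_same_card)
  also have "\<dots> = fact (card (S - {a}) - card K)"
  proof (rule insert.IH)
    show "inj_on i K" using insert.prems by auto
    show "inj_on (?\<tau> \<circ> j) K" using insert.prems by (intro comp_inj_on) auto
    have "a \<notin> i ` K" using insert.prems(2) insert.hyps by (simp add: a_def)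
    then show "i ` K \<subseteq> S - {a}" using insert.prems by blast
    show "(?\<tau> \<circ> j) ` K \<subseteq> S - {a}"
    proof
      fix z assume "z \<in> (?\<tau> \<circ> j) ` K"
      then obtain c where c: "c \<in> K" "z = ?\<tau> (j c)" by auto
      have "b \<notin> j ` K" using insert.prems(3) insert.hyps by (simp add: b_def)
      then have "j c \<noteq> b" using c(1) by blast
      then have "z \<noteq> a" using c by (metis transpose_apply_second transpose_involutory)
      moreover have "z \<in> S" using c insert.prems permutes_in_image[OF \<tau>] by auto
      ultimately show "z \<in> S - {a}" by simp
    qed
  qed (use insert.prems in auto)
  also have "card (S - {a}) - card K = card S - card (insert e K)"
    using ab insert by simp
  finally show ?case .
qed

lemma falling_factorial_eq: "k \<le> n \<Longrightarrow> (\<Prod>i=0..<k. n - i) * fact (n - k) = fact n"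
proof (induction k)
  case (Suc k)
  have "fact (n - k) = (n - k) * fact (n - Suc k)"
    using Suc.prems by (subst fact_reduce) auto
  with Suc show ?case by (simp add: mult.assoc)
qed simp

lemma card_injections:
  assumes "finite A" "finite B" "card A \<le> card B"
  shows "card {f \<in> A \<rightarrow>\<^sub>E B. inj_on f A} * fact (card B - card A) = fact (card B)"
  using card_inj_on_subset_funcset[OF assms(1,2) subset_refl] falling_factorial_eq[OF assms(3)] by simp

text \<open>Each set of size \<open>k\<close> is the image of exactly \<open>k!\<close> injective labellings.\<close>

lemma sum_over_subsets_by_injections:
  fixes g :: "nat set \<Rightarrow> real"
  shows "fact k * (\<Sum>S\<in>{S. S \<subseteq> {..<n} \<and> card S = k}. g S)
       = (\<Sum>i\<in>{i \<in> labellings n {..<k}. inj_on i {..<k}}. g (i ` {..<k}))"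
proof -
  let ?I = "{i \<in> labellings n {..<k}. inj_on i {..<k}}" and ?S = "{S. S \<subseteq> {..<n} \<and> card S = k}"
  have im: "(\<lambda>i. i ` {..<k}) ` ?I \<subseteq> ?S"
  proof
    fix S assume "S \<in> (\<lambda>i. i ` {..<k}) ` ?I"
    then obtain i where i: "S = i ` {..<k}" "i \<in> labellings n {..<k}" "inj_on i {..<k}" by blast
    have "card S = k" using card_image[OF i(3)] i(1) by simp
    moreover have "S \<subseteq> {..<n}" using i(1,2) unfolding labellings_def by blast
    ultimately show "S \<in> ?S" by simp
  qed
  have "finite ?I" "finite ?S" by (auto intro: finite_subset[of _ "Pow {..<n}"])
  then have "(\<Sum>i\<in>?I. g (i ` {..<k})) = (\<Sum>S\<in>?S. \<Sum>i\<in>{i \<in> ?I. i ` {..<k} = S}. g (i ` {..<k}))"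
    using im by (rule sum.group[symmetric])
  also have "\<dots> = (\<Sum>S\<in>?S. fact k * g S)"
  proof (rule sum.cong[OF refl])
    fix S assume S: "S \<in> ?S"
    then have fS: "finite S" by (auto intro: finite_subset)
    have "{i \<in> ?I. i ` {..<k} = S} = {i \<in> {..<k} \<rightarrow>\<^sub>E S. inj_on i {..<k}}"
    proof (intro equalityI subsetI)
      fix i assume "i \<in> {i \<in> {..<k} \<rightarrow>\<^sub>E S. inj_on i {..<k}}"
      then have i: "i \<in> {..<k} \<rightarrow>\<^sub>E S" "inj_on i {..<k}" by auto
      have "i ` {..<k} = S"
        using i fS S by (intro card_subset_eq) (auto simp: card_image)
      then show "i \<in> {i \<in> ?I. i ` {..<k} = S}" using i S by (auto simp: labellings_def PiE_iff)
    qed (auto simp: labellings_def PiE_iff)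
    moreover have "card {i \<in> {..<k} \<rightarrow>\<^sub>E S. inj_on i {..<k}} = fact k"
      using card_injections[of "{..<k}" S] fS S by simp
    ultimately have "card {i \<in> ?I. i ` {..<k} = S} = fact k" by (simp only:)
    moreover have "(\<Sum>i\<in>{i \<in> ?I. i ` {..<k} = S}. g (i ` {..<k})) = (\<Sum>i\<in>{i \<in> ?I. i ` {..<k} = S}. g S)"
      by (rule sum.cong) auto
    ultimately show "(\<Sum>i\<in>{i \<in> ?I. i ` {..<k} = S}. g (i ` {..<k})) = fact k * g S"
      by (simp only: sum_constant of_nat_fact)
  qed
  finally show ?thesis by (simp add: sum_distrib_left)
qed

lemma sum_permutations_prescribed:
  fixes E :: "nat \<Rightarrow> nat \<Rightarrow> real"
  assumes K: "finite K" and i: "i \<in> labellings n K" "inj_on i K"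
  shows "(\<Sum>\<pi>\<in>{\<pi>. \<pi> permutes {..<n}}. \<Prod>e\<in>K. E (i e) (\<pi> (i e)))
       = fact (n - card K) * (\<Sum>j\<in>{j \<in> labellings n K. inj_on j K}. \<Prod>e\<in>K. E (i e) (j e))"
proof -
  let ?P = "{\<pi>. \<pi> permutes {..<n}}" and ?J = "{j \<in> labellings n K. inj_on j K}"
  let ?r = "\<lambda>\<pi>. restrict (\<pi> \<circ> i) K"
  have inL: "i e < n" if "e \<in> K" for e using i(1) that by (auto simp: labellings_def)
  have im: "?r ` ?P \<subseteq> ?J"
  proof
    fix j assume "j \<in> ?r ` ?P"
    then obtain \<pi> where \<pi>: "\<pi> permutes {..<n}" "j = ?r \<pi>" by auto
    have "\<pi> (i e) < n" if "e \<in> K" for e using permutes_in_image[OF \<pi>(1), of "i e"] inL[OF that] by simp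
    moreover have "inj_on (\<pi> \<circ> i) K"
      using i(2) permutes_inj_on[OF \<pi>(1)] by (intro comp_inj_on)
    ultimately show "j \<in> ?J" unfolding \<pi>(2) by (auto simp: labellings_def inj_on_restrict_eq)
  qed
  have "(\<Sum>\<pi>\<in>?P. \<Prod>e\<in>K. E (i e) (\<pi> (i e)))
      = (\<Sum>j\<in>?J. \<Sum>\<pi>\<in>{\<pi> \<in> ?P. ?r \<pi> = j}. \<Prod>e\<in>K. E (i e) (\<pi> (i e)))"
    using K im by (intro sum.group[symmetric]) (auto simp: finite_permutations)
  also have "\<dots> = (\<Sum>j\<in>?J. fact (n - card K) * (\<Prod>e\<in>K. E (i e) (j e)))"
  proof (rule sum.cong[OF refl])
    fix j assume j: "j \<in> ?J"
    have eq: "{\<pi> \<in> ?P. ?r \<pi> = j} = {\<pi>. \<pi> permutes {..<n} \<and> (\<forall>e\<in>K. \<pi> (i e) = j e)}"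
      using j by (auto simp: labellings_def PiE_iff extensional_def fun_eq_iff restrict_def)
    have "(\<Sum>\<pi>\<in>{\<pi> \<in> ?P. ?r \<pi> = j}. \<Prod>e\<in>K. E (i e) (\<pi> (i e)))
        = (\<Sum>\<pi>\<in>{\<pi> \<in> ?P. ?r \<pi> = j}. \<Prod>e\<in>K. E (i e) (j e))"
      unfolding eq by (intro sum.cong prod.cong) auto
    also have "\<dots> = real (card {\<pi>. \<pi> permutes {..<n} \<and> (\<forall>e\<in>K. \<pi> (i e) = j e)}) * (\<Prod>e\<in>K. E (i e) (j e))"
      unfolding eq by simp
    also have "card {\<pi>. \<pi> permutes {..<n} \<and> (\<forall>e\<in>K. \<pi> (i e) = j e)} = fact (card {..<n} - card K)"
      using K i j inL by (intro card_permutes_prescribed) (auto simp: labellings_def)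
    finally show "(\<Sum>\<pi>\<in>{\<pi> \<in> ?P. ?r \<pi> = j}. \<Prod>e\<in>K. E (i e) (\<pi> (i e)))
        = fact (n - card K) * (\<Prod>e\<in>K. E (i e) (j e))"
      by (simp only: card_lessThan of_nat_fact)
  qed
  finally show ?thesis by (simp add: sum_distrib_left)
qed

lemma prod_one_plus_expand:
  fixes x :: "nat \<Rightarrow> real"
  shows "(\<Prod>i<n. 1 + x i) = (\<Sum>k\<le>n. \<Sum>S\<in>{S. S \<subseteq> {..<n} \<and> card S = k}. \<Prod>i\<in>S. x i)"
proof -
  have "(\<Prod>i<n. 1 + x i) = (\<Prod>i<n. x i + 1)" by (simp add: add.commute)
  also have "\<dots> = (\<Sum>S\<in>Pow {..<n}. \<Prod>i\<in>S. x i)"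
    by (subst prod_add) auto
  also have "\<dots> = (\<Sum>k\<le>n. \<Sum>S\<in>{S \<in> Pow {..<n}. card S = k}. \<Prod>i\<in>S. x i)"
  proof (rule sum.group[symmetric])
    show "card ` Pow {..<n} \<subseteq> {..n}" using card_mono[of "{..<n}"] by fastforce
  qed auto
  finally show ?thesis by (simp add: Pow_def)
qed

text \<open>Expand \<open>\<Prod>i. 1 + E (i, \<pi> i)\<close> over the set of rows where the entry of \<open>E\<close> is chosen. A partial matching of
size \<open>k\<close> is completed to a permutation in \<open>(n - k)!\<close> ways.\<close>

lemma permanent_ones_plus:
  fixes E :: "real mat"
  assumes E: "E \<in> carrier_mat n n"
  shows "permanent (all_ones_mat n + E) / fact n
       = (\<Sum>k\<le>n. fact (n - k) / (fact k * fact n) * injective_sum (\<lambda>i j. E $$ (i, j)) n {..<k})"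
proof -
  let ?P = "{\<pi>. \<pi> permutes {..<n}}" and ?e = "\<lambda>i j. E $$ (i, j)"
  let ?S = "\<lambda>k. {S. S \<subseteq> {..<n} \<and> card S = k}"
  have "permanent (all_ones_mat n + E) = (\<Sum>\<pi>\<in>?P. \<Prod>i<n. 1 + ?e i (\<pi> i))"
    using E by (auto simp: permanent_def all_ones_mat_def atLeast0LessThan permutes_in_image
        intro!: sum.cong prod.cong)
  also have "\<dots> = (\<Sum>k\<le>n. \<Sum>S\<in>?S k. \<Sum>\<pi>\<in>?P. \<Prod>i\<in>S. ?e i (\<pi> i))"
    unfolding prod_one_plus_expand
    by (subst sum.swap, rule sum.cong[OF refl], rule sum.swap)
  also have "\<dots> = (\<Sum>k\<le>n. fact (n - k) / fact k * injective_sum ?e n {..<k})"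
  proof (rule sum.cong[OF refl])
    fix k
    have "fact k * (\<Sum>S\<in>?S k. \<Sum>\<pi>\<in>?P. \<Prod>i\<in>S. ?e i (\<pi> i))
        = (\<Sum>i\<in>{i \<in> labellings n {..<k}. inj_on i {..<k}}. \<Sum>\<pi>\<in>?P. \<Prod>x\<in>i ` {..<k}. ?e x (\<pi> x))"
      by (rule sum_over_subsets_by_injections)
    also have "\<dots> = (\<Sum>i\<in>{i \<in> labellings n {..<k}. inj_on i {..<k}}. fact (n - k) *
        (\<Sum>j\<in>{j \<in> labellings n {..<k}. inj_on j {..<k}}. \<Prod>e<k. ?e (i e) (j e)))"
    proof (rule sum.cong[OF refl])
      fix i assume i: "i \<in> {i \<in> labellings n {..<k}. inj_on i {..<k}}"
      then have "(\<Sum>\<pi>\<in>?P. \<Prod>x\<in>i ` {..<k}. ?e x (\<pi> x)) = (\<Sum>\<pi>\<in>?P. \<Prod>e<k. ?e (i e) (\<pi> (i e)))"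
        by (simp add: prod.reindex)
      also have "\<dots> = fact (n - card {..<k}) *
        (\<Sum>j\<in>{j \<in> labellings n {..<k}. inj_on j {..<k}}. \<Prod>e<k. ?e (i e) (j e))"
        using i by (intro sum_permutations_prescribed) auto
      finally show "(\<Sum>\<pi>\<in>?P. \<Prod>x\<in>i ` {..<k}. ?e x (\<pi> x)) = fact (n - k) *
        (\<Sum>j\<in>{j \<in> labellings n {..<k}. inj_on j {..<k}}. \<Prod>e<k. ?e (i e) (j e))" by simp
    qed
    finally have "fact k * (\<Sum>S\<in>?S k. \<Sum>\<pi>\<in>?P. \<Prod>i\<in>S. ?e i (\<pi> i)) = fact (n - k) * injective_sum ?e n {..<k}"
      by (simp only: injective_sum_def sum_distrib_left)
    then show "(\<Sum>S\<in>?S k. \<Sum>\<pi>\<in>?P. \<Prod>i\<in>S. ?e i (\<pi> i)) = fact (n - k) / fact k * injective_sum ?e n {..<k}"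
      by (simp only: times_divide_eq_left) (simp only: nonzero_eq_divide_eq[OF fact_nonzero] mult.commute)
  qed
  finally show ?thesis by (simp add: sum_divide_distrib field_simps)
qed

section \<open>Estimates for the expansion\<close>

lemma power_self_le_fact: "real k ^ k \<le> 3 ^ k * fact k"
proof -
  have "(\<Sum>i\<in>{k}. real k ^ i /\<^sub>R fact i) \<le> (\<Sum>i. real k ^ i /\<^sub>R fact i)"
    by (intro sum_le_suminf summable_exp_generic) auto
  then have "real k ^ k / fact k \<le> exp (real k)"
    by (simp add: exp_def divide_inverse mult.commute)
  also have "\<dots> = exp 1 ^ k" by (simp flip: exp_of_nat_mult)
  also have "\<dots> \<le> 3 ^ k" by (intro power_mono exp_le) simp
  finally show ?thesis by (simp add: divide_le_eq)
qed

lemma falling_factorial_ratio: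
  assumes "k \<le> n" "0 < n"
  shows "fact n / (fact (n - k) * real n ^ k) = (\<Prod>i<k. 1 - real i / real n)"
proof -
  have "fact n = (\<Prod>i=0..<k. real (n - i)) * fact (n - k)"
    using falling_factorial_eq[OF assms(1)] by (metis of_nat_fact of_nat_mult of_nat_prod)
  also have "(\<Prod>i=0..<k. real (n - i)) = (\<Prod>i<k. (1 - real i / real n) * real n)"
    using assms by (intro prod.cong) (auto simp: field_simps atLeast0LessThan)
  finally show ?thesis using assms by (simp add: prod.distrib)
qed

text \<open>With \<open>r k = \<Prod>i<k. 1 - i / n\<close>, the ratio is \<open>1 / r k\<close>. Replacing \<open>n\<close> by the smaller \<open>k\<close> decreases each
factor, so \<open>r k \<ge> k! / k\<^bsup>k\<^esup> \<ge> 3\<^bsup>-k\<^esup>\<close>; and \<open>r k \<ge> 1 - (\<Sum>i<k. i / n) \<ge> 1 - k\<^sup>2 / n\<close>.\<close>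

lemma falling_factorial_ratio_bounds:
  assumes k: "k \<le> n" "0 < n"
  defines "\<rho> \<equiv> fact (n - k) * real n ^ k / fact n"
  shows "1 \<le> \<rho>" "\<rho> \<le> 3 ^ k" "\<rho> - 1 \<le> real k ^ 2 * 3 ^ k / real n"
proof -
  define r where "r m = (\<Prod>i<m. 1 - real i / real n)" for m
  have \<rho>: "\<rho> = 1 / r k" unfolding r_def falling_factorial_ratio[OF k, symmetric] \<rho>_def by simp
  have r01: "0 \<le> r m" "r m \<le> 1" if "m \<le> n" for m
    unfolding r_def using that by (auto intro!: prod_nonneg prod_le_1 simp: field_simps)
  have lower: "1 - real m ^ 2 / real n \<le> r m" if "m \<le> n" for m
    using that
  proof (induction m)
    case (Suc m)
    have "r (Suc m) = r m - r m * (real m / real n)" by (simp add: r_def algebra_simps)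
    moreover have "r m * (real m / real n) \<le> real m / real n"
      using r01(2)[of m] Suc.prems mult_right_mono[of "r m" 1 "real m / real n"] by simp
    ultimately have "1 - real m ^ 2 / real n - real m / real n \<le> r (Suc m)" using Suc by simp
    moreover have "real (Suc m) ^ 2 / real n \<ge> real m ^ 2 / real n + real m / real n"
      unfolding add_divide_distrib[symmetric] by (intro divide_right_mono) (auto simp: power2_eq_square algebra_simps)
    ultimately show ?case by linarith
  qed (simp add: r_def)
  have "fact k / real k ^ k \<le> r k"
  proof (cases "k = 0")
    case False
    have "fact k / (fact (k - k) * real k ^ k) = (\<Prod>i<k. 1 - real i / real k)"
      using False by (intro falling_factorial_ratio) auto
    also have "\<dots> \<le> r k" unfolding r_def
    proof (rule prod_mono)
      fix i assume "i \<in> {..<k}"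
      then have "real i / real k \<le> 1" by simp
      moreover have "real i / real n \<le> real i / real k"
        by (rule frac_le) (use k False in auto)
      ultimately show "0 \<le> 1 - real i / real k \<and> 1 - real i / real k \<le> 1 - real i / real n" by simp
    qed
    finally show ?thesis by simp
  qed (simp add: r_def)
  moreover have "1 / 3 ^ k \<le> fact k / real k ^ k"
    using power_self_le_fact[of k] by (cases "k = 0") (auto simp: field_simps)
  ultimately have r3: "1 / 3 ^ k \<le> r k" by linarith
  then have rpos: "0 < r k" by (rule less_le_trans[rotated]) simp
  show "1 \<le> \<rho>" unfolding \<rho> using rpos r01[OF k(1)] by simp
  show le3: "\<rho> \<le> 3 ^ k" unfolding \<rho> using rpos r3 by (simp add: field_simps)
  have "\<rho> - 1 = \<rho> * (1 - r k)" unfolding \<rho> using rpos by (simp add: field_simps)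
  also have "\<dots> \<le> 3 ^ k * (real k ^ 2 / real n)"
    using le3 lower[OF k(1)] r01[OF k(1)] by (intro mult_mono) auto
  finally show "\<rho> - 1 \<le> real k ^ 2 * 3 ^ k / real n" by (simp add: mult.commute)
qed

text \<open>The smallness parameter is \<open>y = sqrt (s / n)\<close>; the threshold \<open>\<theta>\<close> depends only on the entry bound \<open>C\<close>.
The constant 288 is such that the factors \<open>4\<close> (from two forests), \<open>3\<close> (from \<open>k\<^bsup>k\<^esup> \<le> 3\<^bsup>k\<^esup> k!\<close>) and \<open>C\<close> per
edge combine with \<open>\<theta>\<close> to \<open>1 / 24\<close>; after the losses of \<open>3\<^bsup>k\<^esup>\<close> from the falling factorial and of \<open>k\<^sup>2 \<le> 4\<^bsup>k\<^esup>\<close>,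
a ratio of \<open>1 / 2\<close> is left.\<close>

locale balanced_perturbation =
  fixes E :: "nat \<Rightarrow> nat \<Rightarrow> real" and n :: nat and C s \<theta> y :: real
  assumes n: "0 < n" and C: "1 \<le> C"
    and entry: "\<And>i j. i < n \<Longrightarrow> j < n \<Longrightarrow> \<bar>E i j\<bar> \<le> C"
    and row_abs: "\<And>i. i < n \<Longrightarrow> (\<Sum>j<n. \<bar>E i j\<bar>) \<le> s"
    and col_abs: "\<And>j. j < n \<Longrightarrow> (\<Sum>i<n. \<bar>E i j\<bar>) \<le> s"
    and row_zero: "\<And>i. i < n \<Longrightarrow> (\<Sum>j<n. E i j) = 0"
    and col_zero: "\<And>j. j < n \<Longrightarrow> (\<Sum>i<n. E i j) = 0"
    and \<theta>_def: "\<theta> = 1 / (288 * C)"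
    and y_def: "y = sqrt (s / real n)"
    and small: "y \<le> \<theta>"
begin

lemma s_nonneg: "0 \<le> s"
  using row_abs[OF n] sum_nonneg[of "{..<n}" "\<lambda>j. \<bar>E 0 j\<bar>"] by linarith

lemma \<theta>_pos: "0 < \<theta>" and \<theta>_le: "\<theta> \<le> 1 / 288"
  using C by (auto simp: \<theta>_def field_simps)

lemma y_nonneg: "0 \<le> y"
  using s_nonneg by (simp add: y_def)

lemma sqrt_ns: "sqrt (real n * s) = real n * y"
proof -
  have "real n * s = (real n)\<^sup>2 * (s / real n)" using n by (simp add: power2_eq_square)
  then have "sqrt (real n * s) = sqrt ((real n)\<^sup>2) * sqrt (s / real n)"
    by (simp only: real_sqrt_mult)
  then show ?thesis by (simp add: y_def)
qed

lemma s_eq: "s = real n * y\<^sup>2"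
  using s_nonneg n by (simp add: y_def)

lemma power_weight_le:
  assumes v: "2 \<le> v"
  shows "(real n * y) ^ v \<le> (y / \<theta>)\<^sup>2 * (real n * \<theta>) ^ v"
proof -
  have split: "z ^ v = z\<^sup>2 * z ^ (v - 2)" for z :: real
    using v by (metis le_add_diff_inverse power_add)
  have "y ^ v = y\<^sup>2 * y ^ (v - 2)" by (rule split)
  also have "\<dots> \<le> y\<^sup>2 * \<theta> ^ (v - 2)"
    using small y_nonneg by (intro mult_left_mono power_mono) auto
  also have "\<dots> = (y / \<theta>)\<^sup>2 * \<theta> ^ v"
    using \<theta>_pos by (simp add: power_divide split[of \<theta>])
  finally have "real n ^ v * y ^ v \<le> real n ^ v * ((y / \<theta>)\<^sup>2 * \<theta> ^ v)"
    by (rule mult_left_mono) simp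
  then show ?thesis by (simp add: power_mult_distrib mult_ac)
qed

text \<open>A multigraph with \<open>v\<close> vertices contributes at most \<open>C\<^bsup>k\<^esup> (n y)\<^bsup>v\<^esup>\<close>. Two of the factors \<open>y\<close> are kept, which
gives the factor \<open>y\<^sup>2 = s / n\<close> of the final bound, and the others are replaced by \<open>\<theta>\<close>. The power
\<open>(n \<theta>)\<^bsup>v\<^esup>\<close> is then rewritten with weight \<open>k\<close> per root. At this weight the sum over forests is at most
\<open>(2 k)\<^bsup>k\<^esup>\<close>, whose square is compensated by \<open>k\<^bsup>-k\<^esup>\<close> and \<open>1 / k!\<close> up to an exponential in \<open>k\<close>. Each vertex missing
from the maximal number \<open>k\<close> costs \<open>k / (n \<theta>)\<close>.\<close>

lemma edge_sum_le:
  assumes k: "1 \<le> k" and f: "f \<in> forests {..<k}" and g: "g \<in> forests {..<k}"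
    and sp: "sprouting {..<k} f" "sprouting {..<k} g"
  defines "v \<equiv> card (roots {..<k} f) + card (roots {..<k} g)"
  shows "\<bar>edge_sum E n {..<k} f g\<bar> \<le> C ^ k * (y / \<theta>)\<^sup>2 * (real n * \<theta> / k) ^ k *
           (k / (real n * \<theta>)) ^ (k - v) * (real k ^ card (roots {..<k} f) * real k ^ card (roots {..<k} g))"
proof -
  have one: "1 \<le> card (roots {..<k} f)" if "f \<in> forests {..<k}" for f
  proof -
    have "f 0 \<in> {b \<in> {..<k}. b \<le> 0}"
      by (rule PiE_mem[OF that[unfolded forests_def]]) (use k in simp)
    then have "roots {..<k} f \<noteq> {}" using k by (auto simp: roots_def)
    then have "0 < card (roots {..<k} f)" by (simp add: card_gt_0_iff)
    then show ?thesis by linarith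
  qed
  have v: "2 \<le> v" using one[OF f] one[OF g] by (simp add: v_def)
  have vk: "v \<le> k" using sprouting_card[OF _ sp(1)] sprouting_card[OF _ sp(2)] by (simp add: v_def)
  define x where "x = real n * \<theta>"
  have x: "0 < x" using n \<theta>_pos by (simp add: x_def)
  have "\<bar>edge_sum E n {..<k} f g\<bar> \<le> C ^ k * (real n * y) ^ v"
    using edge_sum_abs_le[OF _ f g entry C col_abs row_abs s_nonneg] by (simp add: v_def sqrt_ns)
  also have "\<dots> \<le> C ^ k * ((y / \<theta>)\<^sup>2 * x ^ v)"
    using power_weight_le[OF v] C by (intro mult_left_mono) (auto simp: x_def)
  also have "x ^ v = (x / k) ^ k * (k / x) ^ (k - v) * real k ^ v"
  proof -
    have "(x / k) ^ k = (x / k) ^ (k - v) * (x / k) ^ v" using vk by (simp flip: power_add)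
    then have "(x / k) ^ k * (k / x) ^ (k - v) * real k ^ v
        = ((x / k) ^ (k - v) * (k / x) ^ (k - v)) * ((x / k) ^ v * real k ^ v)"
      by (simp only: mult_ac)
    also have "(x / k) ^ (k - v) * (k / x) ^ (k - v) = 1"
      using x k by (simp flip: power_mult_distrib)
    also have "(x / k) ^ v * real k ^ v = x ^ v" using k by (simp add: power_divide)
    finally show ?thesis by simp
  qed
  finally show ?thesis unfolding x_def by (simp add: v_def power_add mult.assoc)
qed

lemma edge_sum_zero:
  assumes "f \<in> forests {..<k}" "g \<in> forests {..<k}" "\<not> (sprouting {..<k} f \<and> sprouting {..<k} g)"
  shows "edge_sum E n {..<k} f g = 0"
  using assms edge_sum_eq_0_left[of "{..<k}" f n E g] edge_sum_eq_0_right[of "{..<k}" g n E f]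
    col_zero row_zero by blast

text \<open>The weighted number of forests is at most \<open>(k + k)\<^bsup>k\<^esup>\<close> by \<open>sum_power_roots_le\<close>, once for the rows and once
for the columns.\<close>

lemma sum_pairs_le:
  assumes "1 \<le> k" and "Z \<subseteq> forests {..<k} \<times> forests {..<k}" and "0 \<le> b"
    and "\<And>f g. (f, g) \<in> Z \<Longrightarrow>
      \<bar>edge_sum E n {..<k} f g\<bar> \<le> b * (real k ^ card (roots {..<k} f) * real k ^ card (roots {..<k} g))"
  shows "(\<Sum>(f, g)\<in>Z. \<bar>edge_sum E n {..<k} f g\<bar>) \<le> b * (4 * (real k)\<^sup>2) ^ k"
proof -
  let ?F = "forests {..<k}" and ?w = "\<lambda>f. real k ^ card (roots {..<k} f)"
  have "(\<Sum>(f, g)\<in>Z. \<bar>edge_sum E n {..<k} f g\<bar>) \<le> (\<Sum>(f, g)\<in>Z. b * (?w f * ?w g))"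
    using assms(4) by (intro sum_mono) auto
  also have "\<dots> \<le> (\<Sum>(f, g)\<in>?F \<times> ?F. b * (?w f * ?w g))"
    using assms(2,3) by (intro sum_mono2) auto
  also have "\<dots> = b * (\<Sum>f\<in>?F. ?w f)\<^sup>2"
    by (simp add: sum.cartesian_product[symmetric] sum_distrib_left[symmetric] power2_eq_square sum_product)
  also have "(\<Sum>f\<in>?F. ?w f)\<^sup>2 \<le> ((2 * real k) ^ k)\<^sup>2"
    using sum_power_roots_le[of "{..<k}" "real k"] by (intro power_mono) (auto intro!: sum_nonneg)
  also have "((2 * real k) ^ k)\<^sup>2 = (4 * (real k)\<^sup>2) ^ k"
  proof -
    have "((2 * real k) ^ k)\<^sup>2 = ((2 * real k)\<^sup>2) ^ k" by (metis power_mult mult.commute)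
    also have "(2 * real k)\<^sup>2 = 4 * (real k)\<^sup>2" by (simp only: power_mult_distrib) simp
    finally show ?thesis .
  qed
  finally show ?thesis using assms(3) by (simp add: mult_left_mono)
qed

lemma weight_eq:
  assumes "1 \<le> k"
  shows "(real n * \<theta> / k) ^ k * (4 * (real k)\<^sup>2) ^ k * C ^ k = (real n ^ k) * (real k ^ k / 72 ^ k)"
proof -
  have "(real n * \<theta> / k) ^ k * (4 * (real k)\<^sup>2) ^ k * C ^ k
      = (real n * \<theta> / k * (4 * (real k)\<^sup>2) * C) ^ k"
    by (simp only: power_mult_distrib)
  also have "real n * \<theta> / k * (4 * (real k)\<^sup>2) * C = real n * (real k / 72) * (288 * C * \<theta>)"
    using assms by (simp add: power2_eq_square)
  also have "288 * C * \<theta> = 1" using C by (simp add: \<theta>_def)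
  finally show ?thesis by (simp only: mult_1_right power_mult_distrib power_divide)
qed

text \<open>The terms of the two series to be compared: \<open>pair_coeff\<close> sums to \<open>det (I - E\<^sup>T E / n\<^sup>2)\<^bsup>-1/2\<^esup>\<close>, and
\<open>perm_coeff\<close>, which is cut off at \<open>n\<close>, to \<open>per (J + E) / n!\<close>.\<close>

definition pair_coeff :: "nat \<Rightarrow> real" where
  "pair_coeff k = wick_sum E n {..<k} / (fact k * real n ^ k)"

definition perm_coeff :: "nat \<Rightarrow> real" where
  "perm_coeff k = (if k \<le> n then fact (n - k) / (fact k * fact n) * injective_sum E n {..<k} else 0)"

lemma power_self_div_fact: "real k ^ k / 72 ^ k / fact k \<le> 1 / 24 ^ k"
proof -
  have "real k ^ k / 72 ^ k / fact k \<le> 3 ^ k * fact k / 72 ^ k / fact k"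
    by (intro divide_right_mono power_self_le_fact) auto
  also have "\<dots> = 3 ^ k / 72 ^ k" by simp
  also have "\<dots> = (3 / 72) ^ k" by (simp only: power_divide)
  also have "(3 / 72 :: real) = 1 / 24" by simp
  finally show ?thesis by (simp only: power_one_over)
qed

lemma wick_sum_eq_edge_sums:
  "wick_sum E n {..<k} = (\<Sum>(f, g)\<in>pairings {..<k} \<times> pairings {..<k}. edge_sum E n {..<k} f g)"
  unfolding wick_sum_eq_pairing_sum[OF finite_lessThan] by (rule sum.cartesian_product)

lemma pair_coeff_le:
  assumes k: "1 \<le> k"
  shows "\<bar>pair_coeff k\<bar> \<le> (y / \<theta>)\<^sup>2 / 24 ^ k"
proof -
  let ?P = "pairings {..<k}"
  define b where "b = C ^ k * (y / \<theta>)\<^sup>2 * (real n * \<theta> / k) ^ k"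
  have "\<bar>wick_sum E n {..<k}\<bar> \<le> (\<Sum>(f, g)\<in>?P \<times> ?P. \<bar>edge_sum E n {..<k} f g\<bar>)"
    unfolding wick_sum_eq_edge_sums by (rule order.trans[OF sum_abs]) (simp add: split_def)
  also have "\<dots> \<le> b * (4 * (real k)\<^sup>2) ^ k"
  proof (rule sum_pairs_le[OF k])
    show "0 \<le> b" using C \<theta>_pos by (simp add: b_def)
    fix f g assume "(f, g) \<in> ?P \<times> ?P"
    then have "f \<in> forests {..<k}" "g \<in> forests {..<k}" "sprouting {..<k} f" "sprouting {..<k} g"
      "2 * card (roots {..<k} f) = k" "2 * card (roots {..<k} g) = k"
      by (auto simp: pairings_eq)
    moreover from this have "k - (card (roots {..<k} f) + card (roots {..<k} g)) = 0" by simp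
    ultimately show "\<bar>edge_sum E n {..<k} f g\<bar> \<le> b * (real k ^ card (roots {..<k} f) * real k ^ card (roots {..<k} g))"
      using edge_sum_le[OF k, of f g] by (simp add: b_def)
  qed (auto simp: pairings_def)
  also have "\<dots> = (y / \<theta>)\<^sup>2 * ((real n * \<theta> / k) ^ k * (4 * (real k)\<^sup>2) ^ k * C ^ k)"
    by (simp add: b_def mult_ac)
  also have "\<dots> = (y / \<theta>)\<^sup>2 * (real n ^ k * (real k ^ k / 72 ^ k))"
    unfolding weight_eq[OF k] ..
  finally have "\<bar>wick_sum E n {..<k}\<bar> / (fact k * real n ^ k)
      \<le> (y / \<theta>)\<^sup>2 * (real n ^ k * (real k ^ k / 72 ^ k)) / (fact k * real n ^ k)"
    by (rule divide_right_mono) simp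
  also have "\<dots> = (y / \<theta>)\<^sup>2 * (real k ^ k / 72 ^ k / fact k)"
    using n by (simp add: field_simps)
  also have "\<dots> \<le> (y / \<theta>)\<^sup>2 * (1 / 24 ^ k)"
    by (intro mult_left_mono power_self_div_fact) simp
  finally show ?thesis by (simp add: pair_coeff_def abs_mult)
qed

text \<open>Forests that do not sprout contribute nothing, and pairs of pairings contribute exactly the pairing sum,
with sign \<open>+1\<close>. Every remaining pair has \<open>v < k\<close> vertices and gains the factor \<open>k / (n \<theta>)\<close>.\<close>

lemma injective_sum_minus_wick_sum_le:
  assumes k: "1 \<le> k" and kn: "real k \<le> real n * \<theta>"
  shows "\<bar>injective_sum E n {..<k} - wick_sum E n {..<k}\<bar> / (fact k * real n ^ k)
           \<le> (y / \<theta>)\<^sup>2 * (k / (real n * \<theta>)) / 24 ^ k"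
proof -
  let ?K = "{..<k}"
  let ?F = "forests ?K" and ?P = "pairings ?K" and ?s = "forest_sign ?K" and ?e = "edge_sum E n ?K"
  define S where "S = {f \<in> ?F. sprouting ?K f}"
  define Z where "Z = S \<times> S - ?P \<times> ?P"
  define q where "q = real k / (real n * \<theta>)"
  have q: "0 \<le> q" "q \<le> 1" using kn n \<theta>_pos by (auto simp: q_def divide_le_eq)
  define b where "b = C ^ k * (y / \<theta>)\<^sup>2 * (real n * \<theta> / k) ^ k * q"
  have PS: "?P \<subseteq> S" by (auto simp: pairings_eq S_def)
  have fin: "finite S" by (simp add: S_def)
  have "injective_sum E n ?K = (\<Sum>(f, g)\<in>?F \<times> ?F. ?s f * ?s g * ?e f g)"
    unfolding injective_sum_eq_forest_sum[OF finite_lessThan] by (rule sum.cartesian_product)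
  also have "\<dots> = (\<Sum>(f, g)\<in>S \<times> S. ?s f * ?s g * ?e f g)"
  proof (rule sum.mono_neutral_right)
    show "\<forall>p\<in>?F \<times> ?F - S \<times> S. (case p of (f, g) \<Rightarrow> ?s f * ?s g * ?e f g) = 0"
    proof
      fix p assume "p \<in> ?F \<times> ?F - S \<times> S"
      then obtain f g where p: "p = (f, g)" and "f \<in> ?F" "g \<in> ?F" "\<not> (sprouting ?K f \<and> sprouting ?K g)"
        by (cases p) (auto simp: S_def)
      then have "?e f g = 0" by (intro edge_sum_zero)
      then show "(case p of (f, g) \<Rightarrow> ?s f * ?s g * ?e f g) = 0" by (simp add: p)
    qed
  qed (auto simp: S_def)
  also have "\<dots> = (\<Sum>(f, g)\<in>Z. ?s f * ?s g * ?e f g) + (\<Sum>(f, g)\<in>?P \<times> ?P. ?s f * ?s g * ?e f g)"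
    unfolding Z_def using fin PS by (intro sum.subset_diff) auto
  also have "(\<Sum>(f, g)\<in>?P \<times> ?P. ?s f * ?s g * ?e f g) = (\<Sum>(f, g)\<in>?P \<times> ?P. ?e f g)"
    by (intro sum.cong refl) (auto simp: forest_sign_pairings)
  also have "\<dots> = wick_sum E n ?K"
    by (rule wick_sum_eq_edge_sums[symmetric])
  finally have "\<bar>injective_sum E n ?K - wick_sum E n ?K\<bar> = \<bar>\<Sum>(f, g)\<in>Z. ?s f * ?s g * ?e f g\<bar>"
    by simp
  also have "\<dots> \<le> (\<Sum>(f, g)\<in>Z. \<bar>?e f g\<bar>)"
    by (rule order.trans[OF sum_abs]) (auto simp: split_def abs_mult intro!: sum_mono)
  also have "\<dots> \<le> b * (4 * (real k)\<^sup>2) ^ k"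
  proof (rule sum_pairs_le[OF k])
    show "0 \<le> b" using C \<theta>_pos q by (simp add: b_def)
    show "Z \<subseteq> ?F \<times> ?F" by (auto simp: Z_def S_def)
    fix f g assume "(f, g) \<in> Z"
    then have fg: "f \<in> ?F" "g \<in> ?F" "sprouting ?K f" "sprouting ?K g" "\<not> (f \<in> ?P \<and> g \<in> ?P)"
      by (auto simp: Z_def S_def)
    have "2 * card (roots ?K f) \<le> k" "2 * card (roots ?K g) \<le> k"
      using sprouting_card[of ?K f] sprouting_card[of ?K g] fg by auto
    moreover have "2 * card (roots ?K f) \<noteq> k \<or> 2 * card (roots ?K g) \<noteq> k"
      using fg by (auto simp: pairings_eq)
    ultimately have "1 \<le> k - (card (roots ?K f) + card (roots ?K g))" by linarith
    then have "q ^ (k - (card (roots ?K f) + card (roots ?K g))) \<le> q ^ 1"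
      using q by (intro power_decreasing) auto
    then have "C ^ k * (y / \<theta>)\<^sup>2 * (real n * \<theta> / k) ^ k * q ^ (k - (card (roots ?K f) + card (roots ?K g))) \<le> b"
      unfolding b_def using C \<theta>_pos by (intro mult_left_mono) auto
    then have "C ^ k * (y / \<theta>)\<^sup>2 * (real n * \<theta> / k) ^ k * q ^ (k - (card (roots ?K f) + card (roots ?K g)))
        * (real k ^ card (roots ?K f) * real k ^ card (roots ?K g))
      \<le> b * (real k ^ card (roots ?K f) * real k ^ card (roots ?K g))"
      by (rule mult_right_mono) simp
    then show "\<bar>?e f g\<bar> \<le> b * (real k ^ card (roots ?K f) * real k ^ card (roots ?K g))"
      using edge_sum_le[OF k fg(1-4)] unfolding q_def by linarith
  qed
  also have "\<dots> = (y / \<theta>)\<^sup>2 * q * ((real n * \<theta> / k) ^ k * (4 * (real k)\<^sup>2) ^ k * C ^ k)"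
    by (simp add: b_def mult_ac)
  also have "\<dots> = (y / \<theta>)\<^sup>2 * q * (real n ^ k * (real k ^ k / 72 ^ k))"
    unfolding weight_eq[OF k] ..
  finally have "\<bar>injective_sum E n ?K - wick_sum E n ?K\<bar> / (fact k * real n ^ k)
      \<le> (y / \<theta>)\<^sup>2 * q * (real n ^ k * (real k ^ k / 72 ^ k)) / (fact k * real n ^ k)"
    by (rule divide_right_mono) simp
  also have "\<dots> = (y / \<theta>)\<^sup>2 * q * (real k ^ k / 72 ^ k / fact k)"
    using n by (simp add: field_simps)
  also have "\<dots> \<le> (y / \<theta>)\<^sup>2 * q * (1 / 24 ^ k)"
    using q by (intro mult_left_mono power_self_div_fact) simp
  finally show ?thesis by (simp add: q_def)
qed

text \<open>A crude bound without cancellation. It is used only for \<open>k > n \<theta>\<close>, where \<open>s\<^bsup>k\<^esup> / k!\<close> is already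
exponentially small in \<open>k\<close>.\<close>

lemma injective_sum_le:
  assumes k: "k \<le> n"
  shows "\<bar>injective_sum E n {..<k}\<bar> \<le> fact n / fact (n - k) * s ^ k"
proof -
  let ?K = "{..<k}"
  let ?I = "{i \<in> labellings n ?K. inj_on i ?K}"
  have "\<bar>injective_sum E n ?K\<bar> \<le> (\<Sum>i\<in>?I. \<Sum>j\<in>?I. \<Prod>e\<in>?K. \<bar>E (i e) (j e)\<bar>)"
    unfolding injective_sum_def abs_prod[symmetric]
    by (rule order.trans[OF sum_abs], rule sum_mono, rule sum_abs)
  also have "\<dots> \<le> (\<Sum>i\<in>?I. s ^ k)"
  proof (rule sum_mono)
    fix i assume i: "i \<in> ?I"
    have "(\<Sum>j\<in>?I. \<Prod>e\<in>?K. \<bar>E (i e) (j e)\<bar>) \<le> (\<Sum>j\<in>labellings n ?K. \<Prod>e\<in>?K. \<bar>E (i e) (j e)\<bar>)"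
      by (intro sum_mono2) (auto intro: prod_nonneg)
    also have "\<dots> = (\<Prod>e\<in>?K. \<Sum>x<n. \<bar>E (i e) x\<bar>)"
      unfolding labellings_def by (subst prod_sum_PiE) auto
    also have "\<dots> \<le> (\<Prod>e\<in>?K. s)"
    proof (rule prod_mono)
      fix e assume "e \<in> ?K"
      then have "i e < n" using i by (auto simp: labellings_def)
      then show "0 \<le> (\<Sum>x<n. \<bar>E (i e) x\<bar>) \<and> (\<Sum>x<n. \<bar>E (i e) x\<bar>) \<le> s"
        using row_abs by (auto intro: sum_nonneg)
    qed
    finally show "(\<Sum>j\<in>?I. \<Prod>e\<in>?K. \<bar>E (i e) (j e)\<bar>) \<le> s ^ k" by simp
  qed
  also have "\<dots> = real (card ?I) * s ^ k" by simp
  also have "real (card ?I) = fact n / fact (n - k)"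
  proof -
    have "card ?I * fact (n - k) = fact n"
      using card_injections[of ?K "{..<n}"] k by (simp add: labellings_def)
    then have "real (card ?I * fact (n - k)) = real (fact n)" by (rule arg_cong[where f = real])
    then show ?thesis by (simp only: of_nat_mult of_nat_fact nonzero_eq_divide_eq[OF fact_nonzero])
  qed
  finally show ?thesis .
qed

text \<open>For \<open>k \<le> n \<theta>\<close> the error comes from the multigraphs that are not unions of cycles and from replacing the
falling factorial by \<open>n\<^bsup>k\<^esup>\<close>. For \<open>k > n \<theta>\<close> both terms are bounded separately, and the factor
\<open>1 / (n \<theta>)\<close> is paid for by the exponential decay since \<open>n \<theta> < k \<le> 2\<^bsup>k\<^esup>\<close>.\<close>

lemma perm_coeff_minus_pair_coeff:
  assumes k: "1 \<le> k"
  shows "\<bar>perm_coeff k - pair_coeff k\<bar> \<le> 2 * (y / \<theta>)\<^sup>2 / (real n * \<theta>) * (1 / 2) ^ k"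
proof -
  define A where "A = (y / \<theta>)\<^sup>2"
  define x where "x = real n * \<theta>"
  have A: "0 \<le> A" by (simp add: A_def)
  have x: "0 < x" "x \<le> real n" using n \<theta>_pos \<theta>_le by (auto simp: x_def mult_le_cancel_left1)
  have k2: "real k \<le> 2 ^ k" by (rule less_imp_le[OF of_nat_less_two_power])
  have k4: "(real k)\<^sup>2 \<le> 4 ^ k"
  proof -
    have "(real k)\<^sup>2 \<le> (2 ^ k)\<^sup>2" using k2 by (intro power_mono) auto
    also have "((2::real) ^ k)\<^sup>2 = (2\<^sup>2) ^ k" by (metis power_mult mult.commute)
    finally show ?thesis by simp
  qed
  have geo: "c ^ k / 24 ^ k \<le> (1 / 2) ^ k" if "0 \<le> c" "c \<le> 12" for c :: real
  proof -
    have "c ^ k / 24 ^ k = (c / 24) ^ k" by (simp only: power_divide)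
    also have "\<dots> \<le> (1 / 2) ^ k" using that by (intro power_mono) auto
    finally show ?thesis .
  qed
  have pair: "\<bar>pair_coeff k\<bar> \<le> A / 24 ^ k" using pair_coeff_le[OF k] by (simp add: A_def)
  show ?thesis
  proof (cases "real k \<le> x")
    case True
    with x have kn: "k \<le> n" by simp
    define \<rho> where "\<rho> = fact (n - k) * real n ^ k / fact n"
    note \<rho> = falling_factorial_ratio_bounds[OF kn n, folded \<rho>_def]
    define I W where "I = injective_sum E n {..<k}" and "W = wick_sum E n {..<k}"
    define N where "N = (fact k * real n ^ k :: real)"
    have N: "0 < N" using n by (simp add: N_def)
    have "perm_coeff k = \<rho> * (I / N)" using kn n by (simp add: perm_coeff_def \<rho>_def I_def N_def)
    moreover have pairW: "pair_coeff k = W / N" by (simp add: pair_coeff_def W_def N_def)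
    \<comment> \<open>separate the two sources of error\<close>
    ultimately have "perm_coeff k - pair_coeff k = \<rho> * ((I - W) / N) + (\<rho> - 1) * pair_coeff k"
      by (simp add: diff_divide_distrib algebra_simps)
    then have "\<bar>perm_coeff k - pair_coeff k\<bar> \<le> \<rho> * (\<bar>I - W\<bar> / N) + (\<rho> - 1) * \<bar>pair_coeff k\<bar>"
      using \<rho>(1) N abs_triangle_ineq[of "\<rho> * ((I - W) / N)" "(\<rho> - 1) * pair_coeff k"]
      by (simp add: abs_mult)
    also have "\<rho> * (\<bar>I - W\<bar> / N) \<le> 3 ^ k * (A * (k / x) / 24 ^ k)"
      using \<rho> injective_sum_minus_wick_sum_le[OF k] True N
      by (intro mult_mono) (auto simp: I_def W_def N_def A_def x_def)
    also have "3 ^ k * (A * (k / x) / 24 ^ k) = A / x * (3 ^ k * real k / 24 ^ k)" by simp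
    also have "\<dots> \<le> A / x * (3 ^ k * 2 ^ k / 24 ^ k)"
      using A x k2 by (intro mult_left_mono divide_right_mono) auto
    also have "\<dots> = A / x * (6 ^ k / 24 ^ k)" by (simp add: power_mult_distrib[symmetric])
    also have "\<dots> \<le> A / x * (1 / 2) ^ k"
      using A x geo[of 6] by (intro mult_left_mono) auto
    also have "(\<rho> - 1) * \<bar>pair_coeff k\<bar> \<le> ((real k)\<^sup>2 * 3 ^ k / real n) * (A / 24 ^ k)"
      using \<rho> pair by (intro mult_mono) auto
    also have "\<dots> = A / real n * ((real k)\<^sup>2 * 3 ^ k / 24 ^ k)" by simp
    also have "\<dots> \<le> A / x * (4 ^ k * 3 ^ k / 24 ^ k)"
      using A x k4 by (intro mult_mono divide_left_mono divide_right_mono mult_right_mono) auto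
    also have "\<dots> = A / x * (12 ^ k / 24 ^ k)" by (simp add: power_mult_distrib[symmetric])
    also have "\<dots> \<le> A / x * (1 / 2) ^ k"
      using A x geo[of 12] by (intro mult_left_mono) auto
    finally show ?thesis by (simp add: A_def x_def mult_ac)
  next
    case False
    then have xk: "x < real k" by simp
    have small_term: "A * (1 / 4) ^ k \<le> A / x * (1 / 2) ^ k"
    proof -
      have "x * (1 / 4) ^ k \<le> 2 ^ k * (1 / 4) ^ k"
        using order.trans[OF less_imp_le[OF xk] k2] by (rule mult_right_mono) simp
      also have "\<dots> = (1 / 2) ^ k" by (simp add: power_mult_distrib[symmetric])
      finally have "(1 / 4) ^ k \<le> (1 / 2) ^ k / x" using x by (simp add: field_simps)
      from mult_left_mono[OF this A] show ?thesis by simp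
    qed
    have quarter: "c ^ k \<le> (1 / 4) ^ k" if "0 \<le> c" "c \<le> 1 / 4" for c :: real
      using that by (rule power_mono[rotated])
    have "\<bar>perm_coeff k\<bar> \<le> A * (1 / 4) ^ k"
    proof (cases "k \<le> n")
      case True
      have "\<bar>perm_coeff k\<bar> = fact (n - k) / (fact k * fact n) * \<bar>injective_sum E n {..<k}\<bar>"
        using True by (simp add: perm_coeff_def abs_mult)
      also have "\<dots> \<le> fact (n - k) / (fact k * fact n) * (fact n / fact (n - k) * s ^ k)"
        by (intro mult_left_mono injective_sum_le True) auto
      also have "\<dots> = s ^ k / fact k" by simp
      also have "\<dots> \<le> s ^ k * (3 ^ k / real k ^ k)"
      proof -
        have "1 / fact k \<le> 3 ^ k / real k ^ k"
          using power_self_le_fact[of k] k by (simp add: field_simps)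
        from mult_left_mono[OF this, of "s ^ k"] s_nonneg show ?thesis by simp
      qed
      also have "\<dots> = (3 * s / real k) ^ k" by (simp add: power_mult_distrib power_divide)
      also have "\<dots> \<le> (3 * s / x) ^ k"
        using s_nonneg x xk by (intro power_mono divide_left_mono) auto
      also have "3 * s / x = (y / \<theta>)\<^sup>2 * (3 * \<theta>)"
        using n \<theta>_pos by (simp add: s_eq x_def power2_eq_square)
      also have "((y / \<theta>)\<^sup>2 * (3 * \<theta>)) ^ k = A ^ k * (3 * \<theta>) ^ k"
        unfolding A_def by (rule power_mult_distrib)
      also have "\<dots> \<le> A * (1 / 4) ^ k"
      proof (rule mult_mono)
        have "y / \<theta> \<le> 1" using small \<theta>_pos by simp
        then have "A \<le> 1" unfolding A_def using y_nonneg \<theta>_pos by (intro power_le_one) auto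
        then show "A ^ k \<le> A" using A k power_decreasing[of 1 k A] by simp
        show "(3 * \<theta>) ^ k \<le> (1 / 4) ^ k" using \<theta>_pos \<theta>_le by (intro quarter) auto
      qed (use A \<theta>_pos in auto)
      finally show ?thesis .
    qed (use A in \<open>simp add: perm_coeff_def\<close>)
    moreover have "\<bar>pair_coeff k\<bar> \<le> A * (1 / 4) ^ k"
    proof -
      have "A * (1 / 24) ^ k \<le> A * (1 / 4) ^ k" by (intro mult_left_mono quarter A) auto
      then show ?thesis using pair by (simp add: power_one_over)
    qed
    ultimately have "\<bar>perm_coeff k - pair_coeff k\<bar> \<le> 2 * (A / x * (1 / 2) ^ k)"
      using small_term by linarith
    then show ?thesis by (simp add: A_def x_def)
  qed
qed

lemma pair_coeff_0 [simp]: "pair_coeff 0 = 1"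
  by (simp add: pair_coeff_def wick_sum_def labellings_def wick_def)

lemma perm_coeff_0 [simp]: "perm_coeff 0 = 1"
  by (simp add: perm_coeff_def injective_sum_def labellings_def)

lemma summable_pair_coeff: "summable (\<lambda>k. \<bar>pair_coeff k\<bar>)"
proof (rule summable_comparison_test')
  show "summable (\<lambda>k. (y / \<theta>)\<^sup>2 * (1 / 24) ^ k)" by (intro summable_mult summable_geometric) simp
  show "norm \<bar>pair_coeff k\<bar> \<le> (y / \<theta>)\<^sup>2 * (1 / 24) ^ k" if "1 \<le> k" for k
    using pair_coeff_le[OF that] by (simp add: power_one_over)
qed

lemma summable_perm_coeff: "summable perm_coeff"
  by (rule summable_finite[of "{..n}"]) (auto simp: perm_coeff_def)

lemma suminf_perm_coeff: "suminf perm_coeff = (\<Sum>k\<le>n. fact (n - k) / (fact k * fact n) * injective_sum E n {..<k})"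
  by (subst suminf_finite[of "{..n}"]) (auto simp: perm_coeff_def)

lemma suminf_perm_minus_pair:
  "\<bar>suminf perm_coeff - suminf pair_coeff\<bar> \<le> 4 * (y / \<theta>)\<^sup>2 / (real n * \<theta>)"
proof -
  define c where "c = 2 * (y / \<theta>)\<^sup>2 / (real n * \<theta>)"
  have c: "0 \<le> c" using \<theta>_pos by (simp add: c_def)
  have sp: "summable pair_coeff" using summable_pair_coeff by (rule summable_rabs_cancel)
  have geo: "summable (\<lambda>k. c * (1 / 2) ^ k)" by (intro summable_mult summable_geometric) simp
  have le: "\<bar>perm_coeff k - pair_coeff k\<bar> \<le> c * (1 / 2) ^ k" for k
    using perm_coeff_minus_pair_coeff[of k] c by (cases "k = 0") (auto simp: c_def)
  have sd: "summable (\<lambda>k. \<bar>perm_coeff k - pair_coeff k\<bar>)"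
    by (rule summable_comparison_test'[OF geo, of 0]) (use le in simp)
  have "\<bar>suminf perm_coeff - suminf pair_coeff\<bar> = \<bar>\<Sum>k. perm_coeff k - pair_coeff k\<bar>"
    by (simp add: suminf_diff[OF summable_perm_coeff sp])
  also have "\<dots> \<le> (\<Sum>k. \<bar>perm_coeff k - pair_coeff k\<bar>)" by (rule summable_rabs[OF sd])
  also have "\<dots> \<le> (\<Sum>k. c * (1 / 2) ^ k)" by (rule suminf_le[OF le sd geo])
  also have "\<dots> = c * 2" by (subst suminf_mult) (auto simp: suminf_geometric)
  finally show ?thesis by (simp add: c_def)
qed

lemma suminf_pair_coeff_ge: "3 / 4 \<le> suminf pair_coeff"
proof -
  have A: "(y / \<theta>)\<^sup>2 \<le> 1" using small \<theta>_pos y_nonneg by (intro power_le_one) auto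
  have le: "- pair_coeff (Suc k) \<le> 1 / 24 * (1 / 24) ^ k" for k
  proof -
    have "(y / \<theta>)\<^sup>2 / 24 ^ Suc k \<le> 1 / 24 ^ Suc k" by (intro divide_right_mono A) simp
    then show ?thesis using pair_coeff_le[of "Suc k"] by (simp add: power_one_over)
  qed
  have sp: "summable pair_coeff" using summable_pair_coeff by (rule summable_rabs_cancel)
  then have ss: "summable (\<lambda>k. pair_coeff (Suc k))" by (subst summable_Suc_iff)
  have "- (\<Sum>k. pair_coeff (Suc k)) = (\<Sum>k. - pair_coeff (Suc k))" by (rule suminf_minus[OF ss, symmetric])
  also have "\<dots> \<le> (\<Sum>k. 1 / 24 * (1 / 24) ^ k)"
    by (intro suminf_le le summable_minus ss summable_mult summable_geometric) simp
  also have "\<dots> = 1 / 23" by (subst suminf_mult) (auto simp: suminf_geometric)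
  finally show ?thesis using suminf_split_head[OF sp] by simp
qed

end

section \<open>Comparison of the permanent with the determinant\<close>

lemma (in balanced_perturbation) pair_series_squared_det:
  assumes M: "M \<in> carrier_mat n n" and E: "\<And>i j. i < n \<Longrightarrow> j < n \<Longrightarrow> E i j = M $$ (i, j)"
  shows "(suminf pair_coeff)\<^sup>2 *
    Determinant.det (1\<^sub>m n - (1 / (real n)\<^sup>2) \<cdot>\<^sub>m (transpose_mat M * M)) = 1"
proof -
  let ?N = "(1 / real n) \<cdot>\<^sub>m M"
  have wick: "wick_sum (\<lambda>i j. ?N $$ (i, j)) n {..<k} / fact k = pair_coeff k" for k
  proof -
    have "(\<Prod>e<k. ?N $$ (i e, j e)) = (\<Prod>e<k. E (i e) (j e)) / real n ^ k"
      if "i \<in> labellings n {..<k}" "j \<in> labellings n {..<k}" for i j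
    proof -
      have "(\<Prod>e<k. ?N $$ (i e, j e)) = (\<Prod>e<k. E (i e) (j e) / real n)"
        using that M E by (intro prod.cong) (auto simp: labellings_def PiE_iff)
      then show ?thesis by (simp add: prod_dividef)
    qed
    then have "wick_sum (\<lambda>i j. ?N $$ (i, j)) n {..<k} = wick_sum E n {..<k} / real n ^ k"
      by (simp add: wick_sum_def sum_divide_distrib)
    then show ?thesis by (simp add: pair_coeff_def)
  qed
  have "transpose_mat ?N * ?N = (1 / (real n)\<^sup>2) \<cdot>\<^sub>m (transpose_mat M * M)"
    by (rule eq_matI) (use M in \<open>auto simp: scalar_prod_def power2_eq_square sum_divide_distrib sum_distrib_left\<close>)
  moreover have "?N \<in> carrier_mat n n" using M by simp
  ultimately show ?thesis
    using wick_series_squared_det[of ?N n] summable_pair_coeff unfolding wick by simp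
qed

lemma ln_diff_abs_le:
  fixes a b :: real
  assumes "1 / 2 \<le> a" "1 / 2 \<le> b"
  shows "\<bar>ln a - ln b\<bar> \<le> 2 * \<bar>a - b\<bar>"
proof -
  have *: "ln x - ln z \<le> 2 * \<bar>x - z\<bar>" if "1 / 2 \<le> x" "1 / 2 \<le> z" for x z :: real
  proof -
    have "ln x - ln z \<le> (x - z) / z" using that by (intro ln_diff_le) auto
    also have "\<dots> \<le> \<bar>x - z\<bar> / z" using that by (intro divide_right_mono) auto
    also have "\<dots> \<le> \<bar>x - z\<bar> / (1 / 2)" using that by (intro divide_left_mono) auto
    finally show ?thesis by simp
  qed
  from *[OF assms] *[OF assms(2,1)] show ?thesis by (simp add: abs_le_iff abs_minus_commute)
qed

text \<open>Both series are close to 1, so the logarithm is Lipschitz with constant 2 on the relevant range and the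
additive estimate for the two series carries over to their logarithms.\<close>

lemma (in balanced_perturbation) log_permanent_estimate:
  assumes M: "M \<in> carrier_mat n n" and E: "E = (\<lambda>i j. M $$ (i, j))"
    and large: "16 / \<theta> \<le> real n"
  defines "P \<equiv> permanent (all_ones_mat n + M)"
    and "D \<equiv> Determinant.det (1\<^sub>m n - (1 / (real n)\<^sup>2) \<cdot>\<^sub>m (transpose_mat M * M))"
  shows "0 < P" "0 < D" "\<bar>ln (P / fact n) + 1 / 2 * ln D\<bar> \<le> 8 / \<theta> ^ 3 * (s / (real n)\<^sup>2)"
proof -
  define G where "G = suminf pair_coeff"
  define p where "p = P / fact n"
  have p: "p = suminf perm_coeff"
    unfolding p_def P_def permanent_ones_plus[OF M] suminf_perm_coeff by (simp only: E)
  have G: "3 / 4 \<le> G" unfolding G_def by (rule suminf_pair_coeff_ge)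
  have GD: "G\<^sup>2 * D = 1" unfolding G_def D_def by (rule pair_series_squared_det[OF M]) (simp add: E)
  have D: "D = 1 / G\<^sup>2" using GD G by (simp add: field_simps)
  show D0: "0 < D" unfolding D using G by simp
  have lnD: "1 / 2 * ln D = - ln G" unfolding D using G by (simp add: ln_div ln_realpow)
  have diff: "\<bar>p - G\<bar> \<le> 4 * (y / \<theta>)\<^sup>2 / (real n * \<theta>)"
    unfolding p G_def by (rule suminf_perm_minus_pair)
  have "(y / \<theta>)\<^sup>2 \<le> 1" using small \<theta>_pos y_nonneg by (intro power_le_one) auto
  then have "4 * (y / \<theta>)\<^sup>2 / (real n * \<theta>) \<le> 4 / (real n * \<theta>)"
    using \<theta>_pos by (intro divide_right_mono) auto
  also have "\<dots> \<le> 1 / 4" using large \<theta>_pos n by (simp add: field_simps)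
  finally have pge: "1 / 2 \<le> p" using diff G by linarith
  then have "0 < p" by simp
  then show "0 < P" unfolding p_def by (simp add: zero_less_divide_iff)
  have "\<bar>ln p + 1 / 2 * ln D\<bar> = \<bar>ln p - ln G\<bar>" unfolding lnD by simp
  also have "\<dots> \<le> 2 * \<bar>p - G\<bar>" using pge G by (intro ln_diff_abs_le) auto
  also have "\<dots> \<le> 2 * (4 * (y / \<theta>)\<^sup>2 / (real n * \<theta>))" using diff by simp
  also have "\<dots> = 8 / \<theta> ^ 3 * (s / (real n)\<^sup>2)"
    using n \<theta>_pos by (simp add: s_eq power2_eq_square power3_eq_cube)
  finally show "\<bar>ln (P / fact n) + 1 / 2 * ln D\<bar> \<le> 8 / \<theta> ^ 3 * (s / (real n)\<^sup>2)"
    unfolding p_def .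
qed

lemma line_sums_le_max_abs_line_sum:
  assumes "A \<in> carrier_mat n n"
  shows "i < n \<Longrightarrow> (\<Sum>j<n. \<bar>A $$ (i, j)\<bar>) \<le> max_abs_line_sum A"
    and "j < n \<Longrightarrow> (\<Sum>i<n. \<bar>A $$ (i, j)\<bar>) \<le> max_abs_line_sum A"
  using assms unfolding max_abs_line_sum_def
  by (auto simp: le_max_iff_disj atLeast0LessThan intro!: disjI1[OF Max_ge] disjI2[OF Max_ge])

lemma abs_entry_le_max_abs_entry:
  assumes "A \<in> carrier_mat n n" "i < n" "j < n"
  shows "\<bar>A $$ (i, j)\<bar> \<le> max_abs_entry A"
  unfolding max_abs_entry_def using assms by (intro Max_ge) (auto intro!: image_eqI[of _ _ "(i, j)"])

lemma mult_all_ones_eq_0_iff: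
  fixes A :: "real mat"
  assumes "A \<in> carrier_mat n n"
  shows "A *\<^sub>v all_ones_vec n = 0\<^sub>v n \<longleftrightarrow> (\<forall>i<n. (\<Sum>j<n. A $$ (i, j)) = 0)"
  using assms by (auto simp: vec_eq_iff all_ones_vec_def scalar_prod_def atLeast0LessThan)

theorem theorem2p1:
  fixes C0 :: real
  assumes "0 \<le> C0"
  shows "\<exists>C_perm::real. \<forall>\<eta>::nat \<Rightarrow> real.
    (\<forall>n\<ge>1. 0 \<le> \<eta> n) \<longrightarrow> \<eta> \<longlonglongrightarrow> 0 \<longrightarrow>
    (\<exists>n0\<ge>1. \<forall>n\<ge>n0. \<forall>E\<in>carrier_mat n n.
       E *\<^sub>v all_ones_vec n = 0\<^sub>v n \<longrightarrow>
       transpose_mat E *\<^sub>v all_ones_vec n = 0\<^sub>v n \<longrightarrow>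
       (\<forall>i<n. \<forall>j<n. 0 \<le> (all_ones_mat n + E) $$ (i, j)) \<longrightarrow>
       max_abs_entry E \<le> C0 \<longrightarrow>
       max_abs_line_sum E \<le> \<eta> n * real n \<longrightarrow>
       0 < permanent (all_ones_mat n + E) \<and>
       0 < Determinant.det (1\<^sub>m n - (1 / (real n)\<^sup>2) \<cdot>\<^sub>m (transpose_mat E * E)) \<and>
       \<bar>ln (permanent (all_ones_mat n + E) / fact n)
          + 1 / 2 * ln (Determinant.det (1\<^sub>m n - (1 / (real n)\<^sup>2) \<cdot>\<^sub>m (transpose_mat E * E)))\<bar>
         \<le> C_perm * (max_abs_line_sum E / (real n)\<^sup>2))"
proof -
  define C where "C = max 1 C0"
  define \<theta> where "\<theta> = 1 / (288 * C)"
  have \<theta>: "0 < \<theta>" by (simp add: \<theta>_def C_def)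
  show ?thesis
  proof (rule exI[of _ "8 / \<theta> ^ 3"], intro allI impI)
    fix \<eta> :: "nat \<Rightarrow> real"
    assume \<eta>: "\<eta> \<longlonglongrightarrow> 0"
    have "eventually (\<lambda>n. \<eta> n < \<theta>\<^sup>2) sequentially"
      using \<eta> \<theta> by (intro order_tendstoD) auto
    then obtain n1 where n1: "\<And>n. n1 \<le> n \<Longrightarrow> \<eta> n < \<theta>\<^sup>2"
      by (auto simp: eventually_sequentially)
    define n0 where "n0 = max 1 (max n1 (nat \<lceil>16 / \<theta>\<rceil>))"
    have n0: "1 \<le> n0" "n1 \<le> n0" "nat \<lceil>16 / \<theta>\<rceil> \<le> n0" unfolding n0_def by linarith+
    show "\<exists>n0\<ge>1. \<forall>n\<ge>n0. \<forall>E\<in>carrier_mat n n.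
       E *\<^sub>v all_ones_vec n = 0\<^sub>v n \<longrightarrow>
       transpose_mat E *\<^sub>v all_ones_vec n = 0\<^sub>v n \<longrightarrow>
       (\<forall>i<n. \<forall>j<n. 0 \<le> (all_ones_mat n + E) $$ (i, j)) \<longrightarrow>
       max_abs_entry E \<le> C0 \<longrightarrow>
       max_abs_line_sum E \<le> \<eta> n * real n \<longrightarrow>
       0 < permanent (all_ones_mat n + E) \<and>
       0 < Determinant.det (1\<^sub>m n - (1 / (real n)\<^sup>2) \<cdot>\<^sub>m (transpose_mat E * E)) \<and>
       \<bar>ln (permanent (all_ones_mat n + E) / fact n)
          + 1 / 2 * ln (Determinant.det (1\<^sub>m n - (1 / (real n)\<^sup>2) \<cdot>\<^sub>m (transpose_mat E * E)))\<bar>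
         \<le> 8 / \<theta> ^ 3 * (max_abs_line_sum E / (real n)\<^sup>2)"
    proof (rule exI[of _ n0], intro conjI[OF n0(1)] allI ballI impI)
      fix n and E :: "real mat"
      assume ge: "n0 \<le> n" and E: "E \<in> carrier_mat n n"
        and rows: "E *\<^sub>v all_ones_vec n = 0\<^sub>v n"
        and cols: "transpose_mat E *\<^sub>v all_ones_vec n = 0\<^sub>v n"
        and entries: "max_abs_entry E \<le> C0"
        and lines: "max_abs_line_sum E \<le> \<eta> n * real n"
      have npos: "0 < n" using ge n0(1) by simp
      have cols': "(\<Sum>i<n. E $$ (i, j)) = 0" if "j < n" for j
      proof -
        have "(\<Sum>i<n. transpose_mat E $$ (j, i)) = 0"
          using cols E that by (subst (asm) mult_all_ones_eq_0_iff) auto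
        moreover have "(\<Sum>i<n. transpose_mat E $$ (j, i)) = (\<Sum>i<n. E $$ (i, j))"
          using E that by (intro sum.cong) auto
        ultimately show ?thesis by simp
      qed
      have small: "sqrt (max_abs_line_sum E / real n) \<le> \<theta>"
      proof (rule real_le_lsqrt)
        have "max_abs_line_sum E / real n \<le> \<eta> n" using lines npos by (simp add: divide_le_eq)
        also have "\<dots> \<le> \<theta>\<^sup>2" using n1[of n] ge n0(2) by simp
        finally show "max_abs_line_sum E / real n \<le> \<theta>\<^sup>2" .
      qed (use \<theta> in simp)
      interpret balanced_perturbation "\<lambda>i j. E $$ (i, j)" n C "max_abs_line_sum E" \<theta>
        "sqrt (max_abs_line_sum E / real n)"
      proof
        show "\<bar>E $$ (i, j)\<bar> \<le> C" if "i < n" "j < n" for i j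
          using abs_entry_le_max_abs_entry[OF E that] entries by (simp add: C_def)
        show "(\<Sum>j<n. E $$ (i, j)) = 0" if "i < n" for i
          using rows that mult_all_ones_eq_0_iff[OF E] by blast
      qed (use npos cols' small line_sums_le_max_abs_line_sum[OF E] in \<open>auto simp: C_def \<theta>_def\<close>)
      have "16 / \<theta> \<le> real n" using ge n0(3) real_nat_ceiling_ge[of "16 / \<theta>"] by linarith
      from log_permanent_estimate[OF E refl this]
      show "0 < permanent (all_ones_mat n + E) \<and>
       0 < Determinant.det (1\<^sub>m n - (1 / (real n)\<^sup>2) \<cdot>\<^sub>m (transpose_mat E * E)) \<and>
       \<bar>ln (permanent (all_ones_mat n + E) / fact n)
          + 1 / 2 * ln (Determinant.det (1\<^sub>m n - (1 / (real n)\<^sup>2) \<cdot>\<^sub>m (transpose_mat E * E)))\<bar>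
         \<le> 8 / \<theta> ^ 3 * (max_abs_line_sum E / (real n)\<^sup>2)" by blast
    qed
  qed
qed

end
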